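(* Let $(M,g)$ be a transverse Riemann-Lorentz space with tangent radical and singular hypersurface $\Sigma$. Let $A,B\in\mathfrak{X}_\Sigma$. Then, even in the case where $\Sigma$ is $III$-flat, $Ric(A,B)$ is not well-defined.
   Context: $M$ is a connected smooth manifold of dimension $m>2$ with a smooth symmetric $(0,2)$-tensor field $g=\langle\cdot,\cdot\rangle$ which fails to have maximal rank exactly on a nonempty set $\Sigma\subset M$. $(M,g)$ is a transverse singular space if in every local coordinate system $\det(g_{ab})$ has nonzero differential at the points of $\Sigma$; then $\Sigma$ is a smooth hypersurface (the singular hypersurface) and the radical $Rad_p=\{v\in T_pM: g(v,\cdot)=0\}$, $p\in\Sigma$, is one-dimensional. Tangent radical: $Rad_p\subset T_p\Sigma$ for all $p\in\Sigma$. Riemann-Lorentz: the signature of $g$ changes from Riemannian to Lorentzian across $\Sigma$. $\mathfrak{X}_\Sigma$: smooth vector fields along $\Sigma$; $\mathfrak{X}(\Sigma)$: those tangent to $\Sigma$. For $\mathcal A\in\mathfrak{X}(M)$, $\mathcal A^o=\mathcal A|_{M-\Sigma}$; $\mathcal A$ is an extension of $A=\mathcal A|_\Sigma$. Everything is local: $M$ may be replaced by a small neighbourhood of (a point of) $\Sigma$, and vector fields may be only locally defined. Dual connection: $2\square_{\mathcal A}\mathcal B(\mathcal C)=\mathcal A\langle\mathcal B,\mathcal C\rangle+\mathcal B\langle\mathcal C,\mathcal A\rangle-\mathcal C\langle\mathcal A,\mathcal B\rangle+\langle[\mathcal A,\mathcal B],\mathcal C\rangle-\langle[\mathcal B,\mathcal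 C],\mathcal A\rangle+\langle[\mathcal C,\mathcal A],\mathcal B\rangle$. For a radical vector field $R'$ along $\Sigma$, $II_{R'}(A,B):=\square_AB(R')$ is a well-defined symmetric $C^\infty(\Sigma)$-bilinear map on $\mathfrak{X}_\Sigma$. The main normal $N\in\mathfrak{X}_\Sigma$ satisfies $\langle N,T\Sigma\rangle=0$, $II_{R'}(N,N)=0$ for radical $R'$, $\langle N,N\rangle=1$ (unique up to sign). Second fundamental form: the symmetric tensor $\mathcal H(X,Y):=\square_XY(N)$ on $\Sigma$. The main radical vector field $R\in\mathfrak{X}(\Sigma)$ is in the radical distribution with $\mathcal H(R,R)=-1$ (unique up to sign, the sign of $N$ being chosen to make this possible). $II:=II_R$. Canonical screen distribution: $S_p:=\{v\in T_p\Sigma:\mathcal H(v,R(p))=0\}$; $\Gamma(S)$ is its module of sections. Let $\nabla$ be the Levi-Civita connection on $M-\Sigma$, with curvature $R(\mathcal A,\mathcal B)\mathcal C=\nabla_{\mathcal A}\nabla_{\mathcal B}\mathcal C-\nabla_{\mathcal B}\nabla_{\mathcal A}\mathcal C-\nabla_{[\mathcal A,\mathcal B]}\mathcal C$. $\Sigma$ is $II$-flat if $II(V,W)=0$ for all $V,W\in\Gamma(S)$. If so, for extensions $\mathcal X,\mathcal Y$ of $X,Y\in\mathfrak{X}(\Sigma)$ the field $\nabla_{\mathcal X^o}\mathcal Y^o$ extends smoothly to $\nabla_{\mathcal X}\mathcal Y$ on $M$, and $III(X,Y,Z):=II(\nabla_{\mathcal X}\mathcal Y|_\Sigma,Z)$,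 $X,Y,Z\in\mathfrak{X}(\Sigma)$, is independent of the extensions. $\Sigma$ is $III$-flat if it is $II$-flat and $III(V,W,R)=0$ for all $V,W\in\Gamma(S)$ (equivalently, $II$-flat and $\mathcal H(V,W)=0$ for all $V,W\in\Gamma(S)$). Ricci curvature on $M-\Sigma$ (paper's sign convention): $Ric(\mathcal A^o,\mathcal B^o)$ is the $g$-trace of $(\mathcal E,\mathcal F)\mapsto\langle R(\mathcal A^o,\mathcal E)\mathcal B^o,\mathcal F\rangle$. For $A,B\in\mathfrak{X}_\Sigma$, "$Ric(A,B)$ is well-defined" means: for all extensions $\mathcal A,\mathcal B\in\mathfrak{X}(M)$ of $A,B$, the function $Ric(\mathcal A^o,\mathcal B^o)$ extends smoothly from $M-\Sigma$ to $M$, and the restriction to $\Sigma$ of this extension depends only on $A,B$. *)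

theory Defs
  imports "HOL-Analysis.Analysis"
begin

section \<open>Smooth maps between normed spaces\<close>

text \<open>Only used for open \<open>S\<close> in a finite-dimensional space, where differentiability together with
  \<open>C\<^sup>k\<close> directional derivatives in all fixed directions is \<open>C\<^sup>k\<^sup>+\<^sup>1\<close>.\<close>

primrec Ck_on :: "nat \<Rightarrow> 'e::real_normed_vector set \<Rightarrow> ('e \<Rightarrow> 'f::real_normed_vector) \<Rightarrow> bool" where
  "Ck_on 0 S f \<longleftrightarrow> continuous_on S f"
| "Ck_on (Suc k) S f \<longleftrightarrow> (\<forall>x\<in>S. f differentiable (at x)) \<and>
     (\<forall>v. Ck_on k S (\<lambda>x. frechet_derivative f (at x) v))"

definition smooth_on :: "'e::real_normed_vector set \<Rightarrow> ('e \<Rightarrow> 'f::real_normed_vector) \<Rightarrow> bool" where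
  "smooth_on S f \<longleftrightarrow> (\<forall>k. Ck_on k S f)"


section \<open>Smooth manifolds, tangent vectors, vector fields\<close>

text \<open>A chart is a pair of an open domain and a coordinate map (whose values off the domain are
  irrelevant). The dimension of the manifold is \<open>CARD('n)\<close>.\<close>

type_synonym ('a, 'n) chart = "'a set \<times> ('a \<Rightarrow> real ^ 'n)"

definition cinv :: "('a, 'n::finite) chart \<Rightarrow> real ^ 'n \<Rightarrow> 'a" where
  "cinv c = inv_into (fst c) (snd c)"

definition is_chart :: "('a::topological_space, 'n::finite) chart \<Rightarrow> bool" where
  "is_chart c \<longleftrightarrow> open (fst c) \<and> open (snd c ` fst c) \<and>
     homeomorphism (fst c) (snd c ` fst c) (snd c) (cinv c)"

definition compatible :: "('a, 'n::finite) chart \<Rightarrow> ('a, 'n) chart \<Rightarrow> bool" where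
  "compatible c c' \<longleftrightarrow>
     smooth_on (snd c ` (fst c \<inter> fst c')) (snd c' \<circ> cinv c) \<and>
     smooth_on (snd c' ` (fst c \<inter> fst c')) (snd c \<circ> cinv c')"

text \<open>A tangent vector at \<open>p\<close> is the family of its coordinate columns in all charts around \<open>p\<close>, related by
  the Jacobians of the coordinate changes; it is \<open>0\<close> at all other charts, so that equality
  of tangent vectors is equality of functions.\<close>

type_synonym ('a, 'n) tvec = "('a, 'n) chart \<Rightarrow> real ^ 'n"

type_synonym ('a, 'n) vfield = "'a \<Rightarrow> ('a, 'n) tvec"

type_synonym ('a, 'n) connection = "('a, 'n) vfield \<Rightarrow> ('a, 'n) vfield \<Rightarrow> ('a, 'n) vfield"

locale smooth_manifold =
  fixes M :: "'a::{t2_space, second_countable_topology} set"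
    and atlas :: "('a, 'n::finite) chart set"
  assumes charts: "c \<in> atlas \<Longrightarrow> is_chart c"
    and cover: "(\<Union>c\<in>atlas. fst c) = M"
    and compat: "c \<in> atlas \<Longrightarrow> c' \<in> atlas \<Longrightarrow> compatible c c'"
    and maximal: "is_chart c \<Longrightarrow> fst c \<subseteq> M \<Longrightarrow> (\<forall>c'\<in>atlas. compatible c c') \<Longrightarrow> c \<in> atlas"
begin

definition charts_at :: "'a \<Rightarrow> ('a, 'n) chart set" where
  "charts_at p = {c \<in> atlas. p \<in> fst c}"

definition jac :: "('a, 'n) chart \<Rightarrow> ('a, 'n) chart \<Rightarrow> 'a \<Rightarrow> real ^ 'n \<Rightarrow> real ^ 'n" where
  "jac c c' p = frechet_derivative (snd c' \<circ> cinv c) (at (snd c p))"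

definition tangent :: "'a \<Rightarrow> ('a, 'n) tvec set" where
  "tangent p = {v. (\<forall>c\<in>charts_at p. \<forall>c'\<in>charts_at p. v c' = jac c c' p (v c)) \<and>
                   (\<forall>c. c \<notin> charts_at p \<longrightarrow> v c = 0)}"

definition coord :: "('a, 'n) chart \<Rightarrow> 'n \<Rightarrow> ('a, 'n) vfield" where
  "coord c i p = (\<lambda>c'. if c' \<in> charts_at p then jac c c' p (axis i 1) else 0)"

text \<open>In the following, functions and vector fields on an open set \<open>W \<subseteq> M\<close> are total functions whose
  values off \<open>W\<close> are irrelevant.\<close>

definition smooth_fun :: "'a set \<Rightarrow> ('a \<Rightarrow> real) \<Rightarrow> bool" where
  "smooth_fun W f \<longleftrightarrow> (\<forall>c\<in>atlas. smooth_on (snd c ` (fst c \<inter> W)) (f \<circ> cinv c))"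

definition vector_fields :: "'a set \<Rightarrow> ('a, 'n) vfield set" where
  "vector_fields W = {X. (\<forall>p\<in>W. X p \<in> tangent p) \<and>
     (\<forall>c\<in>atlas. smooth_on (snd c ` (fst c \<inter> W)) (\<lambda>x. X (cinv c x) c))}"

text \<open>The derivative of \<open>f\<close> along a tangent vector at \<open>p\<close>; by the chain rule it does not depend on
  the chart.\<close>

definition dir :: "('a, 'n) tvec \<Rightarrow> ('a \<Rightarrow> real) \<Rightarrow> 'a \<Rightarrow> real" where
  "dir v f p = (let c = SOME c. c \<in> charts_at p in
     frechet_derivative (f \<circ> cinv c) (at (snd c p)) (v c))"

definition lie :: "('a, 'n) vfield \<Rightarrow> ('a, 'n) vfield \<Rightarrow> ('a, 'n) vfield" where
  "lie X Y p = (\<lambda>c. if c \<in> charts_at p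
     then frechet_derivative (\<lambda>x. Y (cinv c x) c) (at (snd c p)) (X p c)
        - frechet_derivative (\<lambda>x. X (cinv c x) c) (at (snd c p)) (Y p c)
     else 0)"

definition smooth_curve :: "real set \<Rightarrow> (real \<Rightarrow> 'a) \<Rightarrow> bool" where
  "smooth_curve I \<gamma> \<longleftrightarrow> continuous_on I \<gamma> \<and> \<gamma> ` I \<subseteq> M \<and>
     (\<forall>c\<in>atlas. smooth_on {t \<in> I. \<gamma> t \<in> fst c} (snd c \<circ> \<gamma>))"

end


section \<open>Possibly degenerate metrics\<close>

locale metric_manifold = smooth_manifold M atlas
  for M :: "'a::{t2_space, second_countable_topology} set"
    and atlas :: "('a, 'n::finite) chart set" +
  fixes g :: "'a \<Rightarrow> ('a, 'n) tvec \<Rightarrow> ('a, 'n) tvec \<Rightarrow> real"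
  assumes g_linear: "p \<in> M \<Longrightarrow> u \<in> tangent p \<Longrightarrow> v \<in> tangent p \<Longrightarrow> w \<in> tangent p \<Longrightarrow>
      g p (\<lambda>c. a *\<^sub>R u c + v c) w = a * g p u w + g p v w"
    and g_sym: "p \<in> M \<Longrightarrow> u \<in> tangent p \<Longrightarrow> v \<in> tangent p \<Longrightarrow> g p u v = g p v u"
    and g_smooth: "c \<in> atlas \<Longrightarrow> smooth_fun (fst c) (\<lambda>p. g p (coord c i p) (coord c j p))"
begin

definition gram :: "('a, 'n) chart \<Rightarrow> 'a \<Rightarrow> real ^ 'n ^ 'n" where
  "gram c p = (\<chi> i j. g p (coord c i p) (coord c j p))"

definition sing :: "'a set" where
  "sing = {p \<in> M. \<exists>c\<in>charts_at p. rank (gram c p) < CARD('n)}"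

definition radical :: "'a \<Rightarrow> ('a, 'n) tvec set" where
  "radical p = {v \<in> tangent p. \<forall>w\<in>tangent p. g p v w = 0}"

definition transverse :: bool where
  "transverse \<longleftrightarrow> (\<forall>c\<in>atlas. \<forall>p\<in>fst c \<inter> sing.
     frechet_derivative (\<lambda>x. det (gram c (cinv c x))) (at (snd c p)) \<noteq> (\<lambda>_. 0))"

text \<open>The tangent space of the hypersurface \<open>sing\<close>: velocities of smooth curves in it.\<close>

definition tangent_sing :: "'a \<Rightarrow> ('a, 'n) tvec set" where
  "tangent_sing p = {v \<in> tangent p. \<exists>\<gamma> \<epsilon>. 0 < \<epsilon> \<and> smooth_curve {-\<epsilon><..<\<epsilon>} \<gamma> \<and> \<gamma> 0 = p \<and>
     (\<forall>t\<in>{-\<epsilon><..<\<epsilon>}. \<gamma> t \<in> sing) \<and>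
     (\<forall>c\<in>charts_at p. v c = vector_derivative (snd c \<circ> \<gamma>) (at 0))}"

definition orthonormal_basis :: "'a \<Rightarrow> ('n \<Rightarrow> real) \<Rightarrow> ('n \<Rightarrow> ('a, 'n) tvec) \<Rightarrow> bool" where
  "orthonormal_basis p s e \<longleftrightarrow> (\<forall>i. e i \<in> tangent p) \<and>
     (\<forall>i j. g p (e i) (e j) = (if i = j then s i else 0))"

definition riemannian_at :: "'a \<Rightarrow> bool" where
  "riemannian_at p \<longleftrightarrow> (\<exists>e. orthonormal_basis p (\<lambda>_. 1) e)"

definition lorentzian_at :: "'a \<Rightarrow> bool" where
  "lorentzian_at p \<longleftrightarrow> (\<exists>k e. orthonormal_basis p (\<lambda>i. if i = k then -1 else 1) e)"

text \<open>Since \<open>det (gram c)\<close> changes sign across \<open>sing\<close> in the transverse case, adherence of every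
  singular point to both regions means that they lie on the two sides of \<open>sing\<close>.\<close>

definition riemann_lorentz :: bool where
  "riemann_lorentz \<longleftrightarrow> (\<forall>p\<in>M - sing. riemannian_at p \<or> lorentzian_at p) \<and>
     (\<forall>p\<in>sing. p \<in> closure {q \<in> M - sing. riemannian_at q} \<and>
                p \<in> closure {q \<in> M - sing. lorentzian_at q})"


subsection \<open>Dual connection and fields along the singular set\<close>

definition ip :: "('a, 'n) vfield \<Rightarrow> ('a, 'n) vfield \<Rightarrow> 'a \<Rightarrow> real" where
  "ip X Y p = g p (X p) (Y p)"

definition dual_conn :: "('a, 'n) vfield \<Rightarrow> ('a, 'n) vfield \<Rightarrow> ('a, 'n) vfield \<Rightarrow> 'a \<Rightarrow> real" where
  "dual_conn X Y Z p =
     (dir (X p) (ip Y Z) p + dir (Y p) (ip Z X) p - dir (Z p) (ip X Y) p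
      + ip (lie X Y) Z p - ip (lie Y Z) X p + ip (lie Z X) Y p) / 2"

text \<open>\<open>extends W X A\<close>: the smooth vector field \<open>X\<close> on \<open>W\<close> is an extension of the field \<open>A\<close> along \<open>sing \<inter> W\<close>.
  Smooth fields along \<open>sing \<inter> W\<close>, which is closed in \<open>W\<close>, are those that have an extension.\<close>

definition extends :: "'a set \<Rightarrow> ('a, 'n) vfield \<Rightarrow> ('a, 'n) vfield \<Rightarrow> bool" where
  "extends W X A \<longleftrightarrow> X \<in> vector_fields W \<and> (\<forall>p\<in>W \<inter> sing. X p = A p)"

definition fields_along :: "'a set \<Rightarrow> ('a, 'n) vfield set" where
  "fields_along W = {A. \<exists>X. extends W X A}"

definition fields_tangent :: "'a set \<Rightarrow> ('a, 'n) vfield set" where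
  "fields_tangent W = {A \<in> fields_along W. \<forall>p\<in>W \<inter> sing. A p \<in> tangent_sing p}"

definition radical_fields :: "'a set \<Rightarrow> ('a, 'n) vfield set" where
  "radical_fields W = {A \<in> fields_along W. \<forall>p\<in>W \<inter> sing. A p \<in> radical p}"

definition some_ext :: "'a set \<Rightarrow> ('a, 'n) vfield \<Rightarrow> ('a, 'n) vfield" where
  "some_ext W A = (SOME X. extends W X A)"

text \<open>The value of \<open>dual_conn\<close> on fields along \<open>sing \<inter> W\<close>, computed with extensions. On \<open>sing\<close> it is
  independent of the extensions in the two cases where it is used: third argument
  radical, or first two arguments tangent to \<open>sing\<close>.\<close>

definition dual_along ::
    "'a set \<Rightarrow> ('a, 'n) vfield \<Rightarrow> ('a, 'n) vfield \<Rightarrow> ('a, 'n) vfield \<Rightarrow> 'a \<Rightarrow> real" where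
  "dual_along W A B C = dual_conn (some_ext W A) (some_ext W B) (some_ext W C)"

definition II :: "'a set \<Rightarrow> ('a, 'n) vfield \<Rightarrow> ('a, 'n) vfield \<Rightarrow> ('a, 'n) vfield \<Rightarrow> 'a \<Rightarrow> real" where
  "II W R A B = dual_along W A B R"

definition second_ff ::
    "'a set \<Rightarrow> ('a, 'n) vfield \<Rightarrow> ('a, 'n) vfield \<Rightarrow> ('a, 'n) vfield \<Rightarrow> 'a \<Rightarrow> real" where
  "second_ff W N X Y = dual_along W X Y N"

definition main_normal :: "'a set \<Rightarrow> ('a, 'n) vfield \<Rightarrow> bool" where
  "main_normal W N \<longleftrightarrow> N \<in> fields_along W \<and> (\<forall>p\<in>W \<inter> sing.
     (\<forall>v\<in>tangent_sing p. g p (N p) v = 0) \<and>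
     (\<forall>R'\<in>radical_fields W. II W R' N N p = 0) \<and>
     ip N N p = 1)"

definition main_radical :: "'a set \<Rightarrow> ('a, 'n) vfield \<Rightarrow> ('a, 'n) vfield \<Rightarrow> bool" where
  "main_radical W N R \<longleftrightarrow> R \<in> fields_tangent W \<inter> radical_fields W \<and>
     (\<forall>p\<in>W \<inter> sing. second_ff W N R R p = -1)"

text \<open>The sections over \<open>sing \<inter> W\<close> of the canonical screen distribution.\<close>

definition screen_fields ::
    "'a set \<Rightarrow> ('a, 'n) vfield \<Rightarrow> ('a, 'n) vfield \<Rightarrow> ('a, 'n) vfield set" where
  "screen_fields W N R = {V \<in> fields_tangent W. \<forall>p\<in>W \<inter> sing. second_ff W N V R p = 0}"

text \<open>The main fields are canonical only up to sign and in general only exist near each point of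
  \<open>sing\<close>; the flatness conditions are imposed on all open \<open>W\<close> carrying a pair of them.\<close>

definition main_pair :: "'a set \<Rightarrow> ('a, 'n) vfield \<Rightarrow> ('a, 'n) vfield \<Rightarrow> bool" where
  "main_pair W N R \<longleftrightarrow> open W \<and> W \<subseteq> M \<and> main_normal W N \<and> main_radical W N R"

definition II_flat :: bool where
  "II_flat \<longleftrightarrow> (\<forall>W N R. main_pair W N R \<longrightarrow>
     (\<forall>V\<in>screen_fields W N R. \<forall>V'\<in>screen_fields W N R. \<forall>p\<in>W \<inter> sing. II W R V V' p = 0))"


subsection \<open>Levi-Civita connection off the singular set, and its curvature\<close>

definition levi_civita :: "('a, 'n) connection \<Rightarrow> bool" where
  "levi_civita D \<longleftrightarrow> (\<forall>W. open W \<and> W \<subseteq> M - sing \<longrightarrow>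
     (\<forall>X\<in>vector_fields W. \<forall>Y\<in>vector_fields W. D X Y \<in> vector_fields W) \<and>
     (\<forall>X\<in>vector_fields W. \<forall>Y\<in>vector_fields W. \<forall>Z\<in>vector_fields W. \<forall>p\<in>W.
        D (\<lambda>q c. X q c + Y q c) Z p = (\<lambda>c. D X Z p c + D Y Z p c) \<and>
        D X (\<lambda>q c. Y q c + Z q c) p = (\<lambda>c. D X Y p c + D X Z p c) \<and>
        D X Y p = (\<lambda>c. D Y X p c + lie X Y p c) \<and>
        dir (X p) (ip Y Z) p = ip (D X Y) Z p + ip Y (D X Z) p) \<and>
     (\<forall>X\<in>vector_fields W. \<forall>Y\<in>vector_fields W. \<forall>f. smooth_fun W f \<longrightarrow> (\<forall>p\<in>W.
        D (\<lambda>q c. f q *\<^sub>R X q c) Y p = (\<lambda>c. f p *\<^sub>R D X Y p c) \<and>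
        D X (\<lambda>q c. f q *\<^sub>R Y q c) p = (\<lambda>c. dir (X p) f p *\<^sub>R Y p c + f p *\<^sub>R D X Y p c))))"

definition curv ::
    "('a, 'n) connection \<Rightarrow> ('a, 'n) vfield \<Rightarrow> ('a, 'n) vfield \<Rightarrow> ('a, 'n) vfield \<Rightarrow> ('a, 'n) vfield" where
  "curv D X Y Z p = (\<lambda>c. D X (D Y Z) p c - D Y (D X Z) p c - D (lie X Y) Z p c)"

text \<open>The trace is taken in a coordinate frame at \<open>p\<close>; it does not depend on the frame.\<close>

definition Ric :: "('a, 'n) connection \<Rightarrow> ('a, 'n) vfield \<Rightarrow> ('a, 'n) vfield \<Rightarrow> 'a \<Rightarrow> real" where
  "Ric D X Y p = (let c = SOME c. c \<in> charts_at p in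
     \<Sum>i\<in>UNIV. \<Sum>j\<in>UNIV. matrix_inv (gram c p) $ i $ j * ip (curv D X (coord c i) Y) (coord c j) p)"

text \<open>\<open>extends_cov D W X Y Z\<close>: for some extensions of \<open>X\<close> and \<open>Y\<close>, the covariant derivative off \<open>sing\<close>
  extends smoothly to \<open>Z\<close> on \<open>W\<close>.\<close>

definition extends_cov ::
    "('a, 'n) connection \<Rightarrow> 'a set \<Rightarrow> ('a, 'n) vfield \<Rightarrow> ('a, 'n) vfield \<Rightarrow> ('a, 'n) vfield \<Rightarrow> bool" where
  "extends_cov D W X Y Z \<longleftrightarrow> Z \<in> vector_fields W \<and>
     (\<exists>X' Y'. extends W X' X \<and> extends W Y' Y \<and> (\<forall>p\<in>W - sing. Z p = D X' Y' p))"

definition III :: "('a, 'n) connection \<Rightarrow> 'a set \<Rightarrow> ('a, 'n) vfield \<Rightarrow>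
    ('a, 'n) vfield \<Rightarrow> ('a, 'n) vfield \<Rightarrow> ('a, 'n) vfield \<Rightarrow> 'a \<Rightarrow> real" where
  "III D W R X Y Z = II W R (SOME C. extends_cov D W X Y C) Z"

definition III_flat :: "('a, 'n) connection \<Rightarrow> bool" where
  "III_flat D \<longleftrightarrow> II_flat \<and> (\<forall>W N R. main_pair W N R \<longrightarrow>
     (\<forall>V\<in>screen_fields W N R. \<forall>V'\<in>screen_fields W N R. \<forall>p\<in>W \<inter> sing. III D W R V V' R p = 0))"

definition Ric_extension ::
    "('a, 'n) connection \<Rightarrow> ('a, 'n) vfield \<Rightarrow> ('a, 'n) vfield \<Rightarrow> ('a \<Rightarrow> real) \<Rightarrow> bool" where
  "Ric_extension D X Y F \<longleftrightarrow> smooth_fun M F \<and> (\<forall>p\<in>M - sing. F p = Ric D X Y p)"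

definition Ric_well_defined ::
    "('a, 'n) connection \<Rightarrow> ('a, 'n) vfield \<Rightarrow> ('a, 'n) vfield \<Rightarrow> bool" where
  "Ric_well_defined D A B \<longleftrightarrow>
     (\<forall>X Y. extends M X A \<and> extends M Y B \<longrightarrow> (\<exists>F. Ric_extension D X Y F)) \<and>
     (\<forall>X Y X' Y' F F'. extends M X A \<and> extends M Y B \<and> extends M X' A \<and> extends M Y' B \<and>
        Ric_extension D X Y F \<and> Ric_extension D X' Y' F' \<longrightarrow> (\<forall>p\<in>sing. F p = F' p))"

end


locale tangent_radical_riemann_lorentz = metric_manifold M atlas g
  for M :: "'a::{t2_space, second_countable_topology} set"
    and atlas :: "('a, 'n::finite) chart set"
    and g :: "'a \<Rightarrow> ('a, 'n) tvec \<Rightarrow> ('a, 'n) tvec \<Rightarrow> real" +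
  assumes dimension: "CARD('n) > 2"
    and connected: "connected M"
    and sing_nonempty: "sing \<noteq> {}"
    and is_transverse: "transverse"
    and is_riemann_lorentz: "riemann_lorentz"
    and tangent_radical: "p \<in> sing \<Longrightarrow> radical p \<subseteq> tangent_sing p"

end

theory Submission
  imports Defs
begin

text \<open>Adding to extensions of \<open>A\<close> and \<open>B\<close> a field \<open>U\<close> that vanishes on the singular hypersurface gives
  other extensions, and by polarisation \<open>Ric(A, B)\<close> can only be well-defined if \<open>Ric(U, U)\<close> tends to \<open>0\<close>
  at the hypersurface. Let \<open>\<delta> = det (g\<^sub>i\<^sub>j)\<close> in a chart and \<open>U = \<beta> \<delta> E\<^sub>a\<close> with a coordinate field \<open>E\<^sub>a\<close>
  and a bump function \<open>\<beta>\<close>. The Christoffel symbols are \<open>Q / \<delta>\<close> with \<open>Q\<close> smooth, so \<open>\<delta>\<^sup>2 Ric(E\<^sub>a, E\<^sub>a)\<close>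
  has a limit that depends on \<open>Q\<close> and \<open>d\<delta>\<close> only. On the hypersurface the adjugate of \<open>(g\<^sub>i\<^sub>j)\<close> is
  \<open>\<rho> r r\<^sup>T\<close> with \<open>r\<close> radical, where \<open>\<rho> dg(r, r) = d\<delta>\<close>, and \<open>d\<delta>(r) = 0\<close> as the radical is
  tangent; this makes the limit \<open>- (d\<delta>(E\<^sub>a))\<^sup>2 / 4\<close>, which by transversality is nonzero for some \<open>a\<close>.\<close>

section \<open>Smooth functions\<close>

text \<open>The double pole has two sources: differentiating \<open>Q / \<delta>\<close> produces
  \<open>- d\<delta> Q / \<delta>^2\<close>, and the quadratic terms of the curvature produce
  \<open>Q Q / \<delta>^2\<close>. Derivatives of Q carry only a simple pole and therefore drop out
  of the limit. Off the hypersurface Ric is tensorial, so the factor \<delta> in U comes out squared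
  and meets exactly this pole. The constant 1/4: on the hypersurface Q(E_i, E_j) is a multiple b_ij
  r of the radical vector, so composing Q with itself involves only b(E_i, r), and Koszul's formula
  gives b(E_i, r) = d\<delta>(E_i) / 2. The trace is b_aa d\<delta>(r) / 2 - d\<delta>(E_a) b(E_a,
  r) / 2; tangency kills the first term. The obstacle is the adjugate at the singular points
  themselves: it must be nonzero and symmetric there. Nonvanishing is extracted from transversality,
  and symmetry is obtained as a limit from regular points.\<close>

lemma Ck_on_cong:
  assumes "open S" "\<And>x. x \<in> S \<Longrightarrow> f x = g x"
  shows "Ck_on k S f \<longleftrightarrow> Ck_on k S g"
proof -
  \<comment> \<open>One implication suffices if both functions are arbitrary: the induction passes
    to their directional derivatives, and exchanging them gives the converse.\<close>
  have "Ck_on k S f \<Longrightarrow> (\<And>x. x \<in> S \<Longrightarrow> f x = g x) \<Longrightarrow> Ck_on k S g" for f g :: "'a \<Rightarrow> 'b"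
  proof (induction k arbitrary: f g)
    case 0 then show ?case by (auto cong: continuous_on_cong)
  next
    case (Suc k)
    have D: "(g has_derivative frechet_derivative f (at x)) (at x)" if "x \<in> S" for x
      using Suc.prems that has_derivative_transform_within_open[OF _ \<open>open S\<close> that, of f _ UNIV g]
      by (auto simp: frechet_derivative_works)
    then have E: "frechet_derivative g (at x) = frechet_derivative f (at x)" if "x \<in> S" for x
      using frechet_derivative_at that by metis
    show ?case
      using Suc.IH[of "\<lambda>x. frechet_derivative f (at x) v" "\<lambda>x. frechet_derivative g (at x) v" for v]
        Suc.prems(1) D E by (auto simp: differentiable_def)
  qed
  then show ?thesis using assms by metis
qed

text \<open>Lets an explicit derivative stand in for \<open>frechet_derivative\<close>: uniqueness
  identifies the two on S, and \<open>Ck_on_cong\<close> transfers the regularity.\<close>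

lemma Ck_on_SucI:
  assumes "open S" "\<And>x. x \<in> S \<Longrightarrow> (f has_derivative f' x) (at x)"
    and "\<And>v. Ck_on k S (\<lambda>x. f' x v)"
  shows "Ck_on (Suc k) S f"
proof -
  have "frechet_derivative f (at x) = f' x" if "x \<in> S" for x
    using assms(2)[OF that] frechet_derivative_at by metis
  then have "Ck_on k S (\<lambda>x. frechet_derivative f (at x) v)" for v
    using assms(3)[of v] Ck_on_cong[OF assms(1), of "\<lambda>x. frechet_derivative f (at x) v" "\<lambda>x. f' x v"] by simp
  then show ?thesis using assms(2) by (auto simp: differentiable_def)
qed

lemma Ck_on_SucD:
  assumes "Ck_on (Suc k) S f"
  shows "x \<in> S \<Longrightarrow> (f has_derivative frechet_derivative f (at x)) (at x)"
    and "Ck_on k S (\<lambda>x. frechet_derivative f (at x) v)"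
  using assms by (auto simp: frechet_derivative_works)

lemma Ck_on_lower: "Ck_on (Suc k) S f \<Longrightarrow> Ck_on k S f"
proof (induction k arbitrary: f)
  case 0
  then show ?case
    by (auto intro!: continuous_at_imp_continuous_on differentiable_imp_continuous_within)
next
  case (Suc k)
  then show ?case by (metis Ck_on.simps(2))
qed

lemma Ck_on_subset: "Ck_on k S f \<Longrightarrow> T \<subseteq> S \<Longrightarrow> Ck_on k T f"
  by (induction k arbitrary: f) (auto intro: continuous_on_subset)

lemma Ck_on_Un:
  assumes "open S" "open T" "Ck_on k S f" "Ck_on k T f"
  shows "Ck_on k (S \<union> T) f"
  using assms(3,4)
proof (induction k arbitrary: f)
  case 0 then show ?case using assms by (auto intro: continuous_on_open_Un)
qed auto

lemma Ck_on_const [simp]: "Ck_on k S (\<lambda>x. c)"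
  by (induction k arbitrary: c) auto

lemma Ck_on_linear:
  assumes "bounded_linear L" "open S" "Ck_on k S f"
  shows "Ck_on k S (\<lambda>x. L (f x))"
  using assms(3)
proof (induction k arbitrary: f)
  case 0 then show ?case
    using assms(1) by (auto intro: bounded_linear.continuous_on)
next
  case (Suc k)
  show ?case
    by (rule Ck_on_SucI[OF assms(2) bounded_linear.has_derivative[OF assms(1) Ck_on_SucD(1)[OF Suc.prems]]])
       (auto intro!: Suc.IH Ck_on_SucD(2)[OF Suc.prems])
qed

lemma Ck_on_add:
  assumes "open S" "Ck_on k S f" "Ck_on k S g"
  shows "Ck_on k S (\<lambda>x. f x + g x)"
  using assms(2,3)
proof (induction k arbitrary: f g)
  case 0 then show ?case by (auto intro: continuous_intros)
next
  case (Suc k)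
  show ?case
    by (rule Ck_on_SucI[OF assms(1) has_derivative_add[OF Ck_on_SucD(1)[OF Suc.prems(1)] Ck_on_SucD(1)[OF Suc.prems(2)]]])
       (auto intro!: Suc.IH Ck_on_SucD(2)[OF Suc.prems(1)] Ck_on_SucD(2)[OF Suc.prems(2)])
qed

text \<open>The product rule leaves one factor undifferentiated, so its regularity has to be lowered
  by one order with \<open>Ck_on_lower\<close>. Scalar multiples, products and inner products are
  instances.\<close>

lemma Ck_on_bilinear:
  assumes "bounded_bilinear b" "open S" "Ck_on k S f" "Ck_on k S g"
  shows "Ck_on k S (\<lambda>x. b (f x) (g x))"
  using assms(3,4)
proof (induction k arbitrary: f g)
  case 0 then show ?case using assms(1) by (auto intro: bounded_bilinear.continuous_on)
next
  case (Suc k)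
  show ?case
    by (rule Ck_on_SucI[OF assms(2) bounded_bilinear.FDERIV[OF assms(1) Ck_on_SucD(1)[OF Suc.prems(1)] Ck_on_SucD(1)[OF Suc.prems(2)]]])
       (auto intro!: Ck_on_add assms(2) Suc.IH Ck_on_SucD(2)[OF Suc.prems(1)] Ck_on_SucD(2)[OF Suc.prems(2)]
          Ck_on_lower[OF Suc.prems(1)] Ck_on_lower[OF Suc.prems(2)])
qed

lemma Ck_on_sum:
  assumes "open S" "\<And>i. i \<in> I \<Longrightarrow> Ck_on k S (f i)"
  shows "Ck_on k S (\<lambda>x. \<Sum>i\<in>I. f i x)"
  using assms(2) by (induction I rule: infinite_finite_induct) (auto intro!: Ck_on_add assms(1))

lemma Ck_on_prod:
  fixes f :: "'i \<Rightarrow> 'a::real_normed_vector \<Rightarrow> real"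
  assumes "open S" "\<And>i. i \<in> I \<Longrightarrow> Ck_on k S (f i)"
  shows "Ck_on k S (\<lambda>x. \<Prod>i\<in>I. f i x)"
  using assms(2)
  by (induction I rule: infinite_finite_induct) (auto intro!: Ck_on_bilinear[OF bounded_bilinear_mult] assms(1))

lemma Ck_on_euclidean:
  fixes f :: "'a::real_normed_vector \<Rightarrow> 'b::euclidean_space"
  assumes "open S" "\<And>b. b \<in> Basis \<Longrightarrow> Ck_on k S (\<lambda>x. f x \<bullet> b)"
  shows "Ck_on k S f"
proof -
  have "Ck_on k S (\<lambda>x. \<Sum>b\<in>Basis. (f x \<bullet> b) *\<^sub>R b)"
    by (intro Ck_on_sum Ck_on_bilinear[OF bounded_bilinear_scaleR] assms) auto
  then show ?thesis by (simp add: euclidean_representation)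
qed

text \<open>The definition differentiates in a fixed direction, whereas the chain rule
  differentiates f in the direction g'(x) v, which moves with x. Expanding that direction in the
  basis leaves fixed directions with coefficients of class C^k; this is why the middle space is
  Euclidean.\<close>

lemma Ck_on_compose:
  fixes g :: "'a::real_normed_vector \<Rightarrow> 'b::euclidean_space"
  assumes "open S" "open T" "g ` S \<subseteq> T" "Ck_on k S g" "Ck_on k T f"
  shows "Ck_on k S (\<lambda>x. f (g x))"
  using assms(4,5)
proof (induction k arbitrary: f)
  case 0 then show ?case using assms(3) by (auto intro: continuous_on_compose2)
next
  case (Suc k)
  let ?f' = "\<lambda>y. frechet_derivative f (at y)" and ?g' = "\<lambda>x. frechet_derivative g (at x)"
  have D: "((\<lambda>x. f (g x)) has_derivative (\<lambda>v. \<Sum>b\<in>Basis. (?g' x v \<bullet> b) *\<^sub>R ?f' (g x) b)) (at x)"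
    if "x \<in> S" for x
  proof -
    have f: "(f has_derivative ?f' (g x)) (at (g x))"
      using Ck_on_SucD(1)[OF Suc.prems(2)] assms(3) that by auto
    then interpret bounded_linear "?f' (g x)" by (rule has_derivative_bounded_linear)
    have "?f' (g x) (?g' x v) = (\<Sum>b\<in>Basis. (?g' x v \<bullet> b) *\<^sub>R ?f' (g x) b)" for v
      by (subst euclidean_representation[symmetric]) (simp add: sum scaleR)
    then show ?thesis
      using has_derivative_compose[OF Ck_on_SucD(1)[OF Suc.prems(1) that] f] by simp
  qed
  show ?case
    by (rule Ck_on_SucI[OF assms(1) D])
       (auto intro!: Ck_on_sum Ck_on_bilinear[OF bounded_bilinear_scaleR] assms(1) Suc.IH
          Ck_on_linear[OF bounded_linear_inner_left] Ck_on_lower[OF Suc.prems(1)]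
          Ck_on_SucD(2)[OF Suc.prems(1)] Ck_on_SucD(2)[OF Suc.prems(2)])
qed

lemma smooth_on_cong:
  "open S \<Longrightarrow> (\<And>x. x \<in> S \<Longrightarrow> f x = g x) \<Longrightarrow> smooth_on S f \<longleftrightarrow> smooth_on S g"
  using Ck_on_cong unfolding smooth_on_def by blast

lemma smooth_on_subset: "smooth_on S f \<Longrightarrow> T \<subseteq> S \<Longrightarrow> smooth_on T f"
  using Ck_on_subset unfolding smooth_on_def by blast

lemma smooth_on_Un: "open S \<Longrightarrow> open T \<Longrightarrow> smooth_on S f \<Longrightarrow> smooth_on T f \<Longrightarrow> smooth_on (S \<union> T) f"
  using Ck_on_Un unfolding smooth_on_def by blast

lemma smooth_on_const [simp]: "smooth_on S (\<lambda>x. c)"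
  unfolding smooth_on_def by simp

lemma smooth_on_linear:
  "bounded_linear L \<Longrightarrow> open S \<Longrightarrow> smooth_on S f \<Longrightarrow> smooth_on S (\<lambda>x. L (f x))"
  using Ck_on_linear unfolding smooth_on_def by blast

lemma smooth_on_add: "open S \<Longrightarrow> smooth_on S f \<Longrightarrow> smooth_on S g \<Longrightarrow> smooth_on S (\<lambda>x. f x + g x)"
  using Ck_on_add unfolding smooth_on_def by blast

lemma smooth_on_bilinear:
  "bounded_bilinear b \<Longrightarrow> open S \<Longrightarrow> smooth_on S f \<Longrightarrow> smooth_on S g \<Longrightarrow> smooth_on S (\<lambda>x. b (f x) (g x))"
  using Ck_on_bilinear unfolding smooth_on_def by blast

lemmas smooth_on_scaleR = smooth_on_bilinear[OF bounded_bilinear_scaleR]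
lemmas smooth_on_mult = smooth_on_bilinear[OF bounded_bilinear_mult]
lemmas smooth_on_inner = smooth_on_bilinear[OF bounded_bilinear_inner]

lemma smooth_on_diff:
  assumes "open S" "smooth_on S f" "smooth_on S g"
  shows "smooth_on S (\<lambda>x. f x - g x)"
  using smooth_on_add[OF assms(1,2) smooth_on_linear[OF bounded_linear_minus[OF bounded_linear_ident] assms(1,3)]]
  by simp

lemma smooth_on_sum:
  "open S \<Longrightarrow> (\<And>i. i \<in> I \<Longrightarrow> smooth_on S (f i)) \<Longrightarrow> smooth_on S (\<lambda>x. \<Sum>i\<in>I. f i x)"
  using Ck_on_sum[of S I _ f] unfolding smooth_on_def by blast

lemma smooth_on_prod:
  fixes f :: "'i \<Rightarrow> 'a::real_normed_vector \<Rightarrow> real"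
  shows "open S \<Longrightarrow> (\<And>i. i \<in> I \<Longrightarrow> smooth_on S (f i)) \<Longrightarrow> smooth_on S (\<lambda>x. \<Prod>i\<in>I. f i x)"
  using Ck_on_prod[of S I _ f] unfolding smooth_on_def by blast

lemma smooth_on_compose:
  fixes g :: "'a::real_normed_vector \<Rightarrow> 'b::euclidean_space"
  shows "open S \<Longrightarrow> open T \<Longrightarrow> g ` S \<subseteq> T \<Longrightarrow> smooth_on S g \<Longrightarrow> smooth_on T f \<Longrightarrow> smooth_on S (\<lambda>x. f (g x))"
  using Ck_on_compose unfolding smooth_on_def by blast

lemma smooth_on_derivative: "smooth_on S f \<Longrightarrow> smooth_on S (\<lambda>x. frechet_derivative f (at x) v)"
  unfolding smooth_on_def by (metis Ck_on_SucD(2))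

lemma smooth_on_has_derivative:
  "smooth_on S f \<Longrightarrow> x \<in> S \<Longrightarrow> (f has_derivative frechet_derivative f (at x)) (at x)"
  unfolding smooth_on_def by (metis Ck_on_SucD(1))

lemma smooth_on_continuous_on: "smooth_on S f \<Longrightarrow> continuous_on S f"
  unfolding smooth_on_def by (metis Ck_on.simps(1))

lemma smooth_on_ident: "open S \<Longrightarrow> smooth_on S (\<lambda>x. x)"
  unfolding smooth_on_def
proof
  fix k assume S: "open S"
  show "Ck_on k S (\<lambda>x. x)" by (cases k) (auto intro!: Ck_on_SucI[OF S has_derivative_ident])
qed

lemma smooth_on_nth:
  fixes f :: "'a::real_normed_vector \<Rightarrow> real ^ 'n"
  shows "open S \<Longrightarrow> smooth_on S f \<Longrightarrow> smooth_on S (\<lambda>x. f x $ i)"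
  by (rule smooth_on_linear[OF bounded_linear_vec_nth])

lemma smooth_on_vec:
  fixes f :: "'a::real_normed_vector \<Rightarrow> real ^ 'n"
  assumes "open S" "\<And>i. smooth_on S (\<lambda>x. f x $ i)"
  shows "smooth_on S f"
  unfolding smooth_on_def
proof
  fix k
  have "Ck_on k S (\<lambda>x. f x \<bullet> b)" if "b \<in> Basis" for b
  proof -
    obtain i where "b = axis i 1" using \<open>b \<in> Basis\<close> by (auto simp: Basis_vec_def)
    then have "f x \<bullet> b = f x $ i" for x by (simp add: inner_axis)
    then show ?thesis using assms(2)[of i] unfolding smooth_on_def by simp
  qed
  then show "Ck_on k S f" by (rule Ck_on_euclidean[OF assms(1)])
qed

section \<open>A smooth bump function\<close>

lemma poly_exp_tendsto_0: "((\<lambda>s. poly p s * exp (- s)) \<longlongrightarrow> (0::real)) at_top"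
proof -
  have "((\<lambda>s. \<Sum>i\<le>degree p. coeff p i * (s ^ i / exp s)) \<longlongrightarrow> (\<Sum>i\<le>degree p. coeff p i * 0)) at_top"
    by (intro tendsto_intros tendsto_power_div_exp_0)
  then show ?thesis
    by (simp add: poly_altdef sum_distrib_right exp_minus divide_inverse mult.assoc)
qed

text \<open>This family of functions is closed under differentiation.\<close>

definition flat_exp :: "real poly \<Rightarrow> real \<Rightarrow> real" where
  "flat_exp p t = (if t > 0 then poly p (1 / t) * exp (- (1 / t)) else 0)"

lemma flat_exp_tendsto_0: "(flat_exp p \<longlongrightarrow> 0) (at 0)"
proof -
  have "((\<lambda>t. poly p (1 / t) * exp (- (1 / t))) \<longlongrightarrow> 0) (at_right 0)"
    using filterlim_compose[OF poly_exp_tendsto_0 filterlim_inverse_at_top_right, of p]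
    by (simp add: inverse_eq_divide)
  then have "(flat_exp p \<longlongrightarrow> 0) (at_right 0)"
    by (rule Lim_transform_eventually) (auto simp: flat_exp_def eventually_at_filter)
  moreover have "(flat_exp p \<longlongrightarrow> 0) (at_left 0)"
    by (rule Lim_transform_eventually[OF tendsto_const]) (auto simp: flat_exp_def eventually_at_filter)
  ultimately show ?thesis by (simp add: filterlim_at_split)
qed

text \<open>With s = 1/t, the t-derivative of p(s) exp(-s) is s^2 (p(s) - p'(s)) exp(-s), and
  \<open>[:0, 0, 1:]\<close> is the polynomial s^2.\<close>

lemma flat_exp_has_derivative:
  "(flat_exp p has_real_derivative flat_exp ([:0, 0, 1:] * (p - pderiv p)) t) (at t)"
proof -
  consider "t > 0" | "t < 0" | "t = 0" by linarith
  then show ?thesis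
  proof cases
    case 1
    have "((\<lambda>t. poly p (1 / t) * exp (- (1 / t))) has_real_derivative
        flat_exp ([:0, 0, 1:] * (p - pderiv p)) t) (at t)"
      using 1 unfolding flat_exp_def
      by (auto intro!: derivative_eq_intros simp: field_simps power2_eq_square)
    then show ?thesis
      by (rule DERIV_cong_ev[THEN iffD1, OF refl _ refl, rotated])
         (use 1 in \<open>auto simp: flat_exp_def eventually_nhds intro!: exI[of _ "{0<..}"]\<close>)
  next
    case 2
    have "((\<lambda>t. 0) has_real_derivative flat_exp ([:0, 0, 1:] * (p - pderiv p)) t) (at t)"
      using 2 by (simp add: flat_exp_def)
    then show ?thesis
      by (rule DERIV_cong_ev[THEN iffD1, OF refl _ refl, rotated])
         (use 2 in \<open>auto simp: flat_exp_def eventually_nhds intro!: exI[of _ "{..<0}"]\<close>)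
  next
    case 3
    \<comment> \<open>At 0 the difference quotient is again a member of the family, because dividing
      by h multiplies the polynomial by s.\<close>
    have "flat_exp p h / h = flat_exp ([:0, 1:] * p) h" for h
      by (simp add: flat_exp_def field_simps)
    then have "(flat_exp p has_real_derivative 0) (at 0)"
      using flat_exp_tendsto_0[of "[:0, 1:] * p"] by (simp add: DERIV_def flat_exp_def[of p 0])
    then show ?thesis using 3 by (simp add: flat_exp_def)
  qed
qed

lemma smooth_on_flat_exp: "smooth_on UNIV (flat_exp p)"
proof -
  have "Ck_on k UNIV (flat_exp p)" for k
  proof (induction k arbitrary: p)
    case 0
    show ?case
      using flat_exp_has_derivative by (auto intro!: continuous_at_imp_continuous_on DERIV_isCont)
  next
    case (Suc k)
    show ?case
      by (rule Ck_on_SucI[OF open_UNIV has_field_derivative_imp_has_derivative[OF flat_exp_has_derivative]])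
         (auto intro!: Ck_on_linear[OF bounded_linear_mult_left] Suc.IH)
  qed
  then show ?thesis by (simp add: smooth_on_def)
qed

text \<open>The witness is positive exactly on the open ball. Squared distance is used because it is
  smooth at the centre as well.\<close>

lemma smooth_bump:
  fixes a :: "'a::euclidean_space"
  assumes "r > 0"
  obtains \<beta> :: "'a \<Rightarrow> real" where "smooth_on UNIV \<beta>" "\<beta> a \<noteq> 0" "\<And>x. x \<notin> cball a r \<Longrightarrow> \<beta> x = 0"
proof
  let ?\<beta> = "\<lambda>x. flat_exp 1 (r\<^sup>2 - (x - a) \<bullet> (x - a))"
  show "smooth_on UNIV ?\<beta>"
    by (rule smooth_on_compose[OF open_UNIV open_UNIV _ _ smooth_on_flat_exp])
       (auto intro!: smooth_on_diff smooth_on_inner smooth_on_ident)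
  show "?\<beta> a \<noteq> 0" using assms by (simp add: flat_exp_def)
  show "?\<beta> x = 0" if "x \<notin> cball a r" for x
  proof -
    have "r\<^sup>2 < (norm (x - a))\<^sup>2"
      using that assms by (intro power_strict_mono) (auto simp: dist_norm norm_minus_commute)
    then show ?thesis by (simp add: flat_exp_def power2_norm_eq_inner)
  qed
qed

text \<open>Both mixed second derivatives are the limit of the second difference quotients over
  parallelograms, by the mean value theorem applied twice.\<close>

lemma second_difference_mvt:
  fixes f :: "'a::real_normed_vector \<Rightarrow> real"
  assumes f: "\<And>y. y \<in> ball x e \<Longrightarrow> (f has_derivative f' y) (at y)"
    and f2: "\<And>y. y \<in> ball x e \<Longrightarrow> ((\<lambda>y. f' y u) has_derivative f'' y) (at y)"
    and t: "0 < t" "t * (norm u + norm v) < e"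
  obtains y where "norm (y - x) \<le> t * (norm u + norm v)"
    "f (x + t *\<^sub>R u + t *\<^sub>R v) - f (x + t *\<^sub>R u) - f (x + t *\<^sub>R v) + f x = t * t * f'' y v"
proof -
  have B: "x + s *\<^sub>R u + r *\<^sub>R v \<in> ball x e" and N: "norm (s *\<^sub>R u + r *\<^sub>R v) \<le> t * (norm u + norm v)"
    if "0 \<le> s" "s \<le> t" "0 \<le> r" "r \<le> t" for s r
  proof -
    have "norm (s *\<^sub>R u + r *\<^sub>R v) \<le> s * norm u + r * norm v"
      using that norm_triangle_ineq[of "s *\<^sub>R u" "r *\<^sub>R v"] by simp
    also have "\<dots> \<le> t * (norm u + norm v)"
      using that by (simp add: distrib_left add_mono mult_right_mono)
    finally show "norm (s *\<^sub>R u + r *\<^sub>R v) \<le> t * (norm u + norm v)" .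
    then show "x + s *\<^sub>R u + r *\<^sub>R v \<in> ball x e"
      using t by (simp add: dist_norm algebra_simps) (metis minus_add_distrib norm_minus_cancel add.commute order.strict_trans1 uminus_add_conv_diff)
  qed
  \<comment> \<open>The increment in direction v as a function of the step s in direction u: the
    first mean value theorem acts on s, the second on the step in direction v. The term
    \<open>0 *\<^sub>R v\<close> gives both summands the shape of \<open>D1\<close>.\<close>
  let ?\<phi> = "\<lambda>s. f (x + s *\<^sub>R u + t *\<^sub>R v) - f (x + s *\<^sub>R u + 0 *\<^sub>R v)"
  have lin: "f' y (c *\<^sub>R w) = c * f' y w" if "y \<in> ball x e" for y c w
    using linear_simps(5)[OF has_derivative_bounded_linear[OF f[OF that]]] by simp
  have lin2: "f'' y (c *\<^sub>R w) = c * f'' y w" if "y \<in> ball x e" for y c w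
    using linear_simps(5)[OF has_derivative_bounded_linear[OF f2[OF that]]] by simp
  have D1: "((\<lambda>s. f (x + s *\<^sub>R u + r *\<^sub>R v)) has_real_derivative f' (x + s *\<^sub>R u + r *\<^sub>R v) u) (at s)"
    if "0 \<le> s" "s \<le> t" "0 \<le> r" "r \<le> t" for s r
  proof -
    have "((\<lambda>s. x + s *\<^sub>R u + r *\<^sub>R v) has_derivative (\<lambda>h. h *\<^sub>R u)) (at s)"
      by (auto intro!: derivative_eq_intros)
    from has_derivative_compose[OF this f[OF B[OF that]]]
    show ?thesis by (simp add: has_field_derivative_def lin[OF B[OF that]] mult_commute_abs)
  qed
  have D: "(?\<phi> has_real_derivative f' (x + s *\<^sub>R u + t *\<^sub>R v) u - f' (x + s *\<^sub>R u + 0 *\<^sub>R v) u) (at s)"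
    if "0 \<le> s" "s \<le> t" for s
    using t(1) by (intro DERIV_diff D1 that) auto
  obtain s where s: "0 < s" "s < t"
    "?\<phi> t - ?\<phi> 0 = (t - 0) * (f' (x + s *\<^sub>R u + t *\<^sub>R v) u - f' (x + s *\<^sub>R u + 0 *\<^sub>R v) u)"
    using MVT2[OF t(1) D] by blast
  have D2: "((\<lambda>r. f' (x + s *\<^sub>R u + r *\<^sub>R v) u) has_real_derivative f'' (x + s *\<^sub>R u + r *\<^sub>R v) v) (at r)"
    if "0 \<le> r" "r \<le> t" for r
  proof -
    have B': "x + s *\<^sub>R u + r *\<^sub>R v \<in> ball x e" using B that s by simp
    have "((\<lambda>r. x + s *\<^sub>R u + r *\<^sub>R v) has_derivative (\<lambda>h. h *\<^sub>R v)) (at r)"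
      by (auto intro!: derivative_eq_intros)
    from has_derivative_compose[OF this f2[OF B']]
    show ?thesis by (simp add: has_field_derivative_def lin2[OF B'] mult_commute_abs)
  qed
  obtain r where r: "0 < r" "r < t"
    "f' (x + s *\<^sub>R u + t *\<^sub>R v) u - f' (x + s *\<^sub>R u + 0 *\<^sub>R v) u = (t - 0) * f'' (x + s *\<^sub>R u + r *\<^sub>R v) v"
    using MVT2[OF t(1) D2] by blast
  show ?thesis
  proof
    show "norm (x + s *\<^sub>R u + r *\<^sub>R v - x) \<le> t * (norm u + norm v)"
      using N[of s r] s r by (simp add: algebra_simps)
    show "f (x + t *\<^sub>R u + t *\<^sub>R v) - f (x + t *\<^sub>R u) - f (x + t *\<^sub>R v) + f x
        = t * t * f'' (x + s *\<^sub>R u + r *\<^sub>R v) v"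
      using s(3) r(3) by simp
  qed
qed

text \<open>Continuity of the iterated derivative allows the intermediate point of the mean value
  theorem to be replaced by x as the parallelogram shrinks.\<close>

lemma second_difference_tendsto:
  fixes f :: "'a::real_normed_vector \<Rightarrow> real"
  assumes S: "open S" "x \<in> S" and f: "smooth_on S f"
  shows "((\<lambda>t. (f (x + t *\<^sub>R u + t *\<^sub>R v) - f (x + t *\<^sub>R u) - f (x + t *\<^sub>R v) + f x) / (t * t)) \<longlongrightarrow>
    frechet_derivative (\<lambda>y. frechet_derivative f (at y) u) (at x) v) (at_right 0)"
proof (rule tendstoI)
  let ?h = "\<lambda>y. frechet_derivative (\<lambda>y. frechet_derivative f (at y) u) (at y) v"
  fix \<epsilon> :: real assume "\<epsilon> > 0"
  obtain e where e: "e > 0" "ball x e \<subseteq> S" using S openE by blast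
  have "isCont ?h x"
    using smooth_on_continuous_on[OF smooth_on_derivative[OF smooth_on_derivative[OF f]]] S
      continuous_on_eq_continuous_at by blast
  then obtain d where d: "d > 0" "\<And>y. dist y x < d \<Longrightarrow> dist (?h y) (?h x) < \<epsilon>"
    using \<open>\<epsilon> > 0\<close> unfolding continuous_at_eps_delta by (auto simp: dist_real_def dist_norm)
  \<comment> \<open>The summand 1 keeps K positive even when u = v = 0, so that one may divide by
    it.\<close>
  define K where "K = norm u + norm v + 1"
  have K: "K > 0" "K > norm u + norm v" unfolding K_def by (auto intro: add_nonneg_pos)
  have "dist ((f (x + t *\<^sub>R u + t *\<^sub>R v) - f (x + t *\<^sub>R u) - f (x + t *\<^sub>R v) + f x) / (t * t)) (?h x) < \<epsilon>"
    if t: "0 < t" "t < min d e / K" for t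
  proof -
    have "t * (norm u + norm v) \<le> t * K" using t K by (intro mult_left_mono) auto
    then have T: "t * (norm u + norm v) < min d e"
      using t K by (meson order.strict_trans1 pos_less_divide_eq)
    obtain y where y: "norm (y - x) \<le> t * (norm u + norm v)"
      "f (x + t *\<^sub>R u + t *\<^sub>R v) - f (x + t *\<^sub>R u) - f (x + t *\<^sub>R v) + f x = t * t * ?h y"
    proof (rule second_difference_mvt[of x e f "\<lambda>y. frechet_derivative f (at y)" u
          "\<lambda>y. frechet_derivative (\<lambda>y. frechet_derivative f (at y) u) (at y)" t v])
      show "(f has_derivative frechet_derivative f (at y)) (at y)"
        and "((\<lambda>y. frechet_derivative f (at y) u) has_derivative
          frechet_derivative (\<lambda>y. frechet_derivative f (at y) u) (at y)) (at y)" if "y \<in> ball x e" for y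
        using that e(2) smooth_on_has_derivative[OF f] smooth_on_has_derivative[OF smooth_on_derivative[OF f]]
        by blast+
    qed (use t T in auto)
    have "dist y x < d" using y(1) T by (simp add: dist_norm)
    from d(2)[OF this] show ?thesis using y(2) t(1) by simp
  qed
  then show "\<forall>\<^sub>F t in at_right 0. dist ((f (x + t *\<^sub>R u + t *\<^sub>R v) - f (x + t *\<^sub>R u) - f (x + t *\<^sub>R v) + f x) / (t * t)) (?h x) < \<epsilon>"
    unfolding eventually_at_right_field using d(1) e(1) K(1)
    by (intro exI[of _ "min d e / K"] conjI allI impI) simp
qed

text \<open>The second difference is symmetric in u and v, so both iterated derivatives are its
  limit. The mean value theorem is about real functions, hence the passage to components.\<close>

lemma mixed_derivatives_commute:
  fixes f :: "'a::real_normed_vector \<Rightarrow> real ^ 'n"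
  assumes S: "open S" "x \<in> S" and f: "smooth_on S f"
  shows "frechet_derivative (\<lambda>y. frechet_derivative f (at y) u) (at x) v
    = frechet_derivative (\<lambda>y. frechet_derivative f (at y) v) (at x) u"
proof -
  have D: "frechet_derivative (\<lambda>y. frechet_derivative f (at y) u) (at x) v $ i
     = frechet_derivative (\<lambda>y. frechet_derivative (\<lambda>y. f y $ i) (at y) u) (at x) v" for i u v
  proof -
    have nth: "frechet_derivative (\<lambda>y. h y $ i) (at y) w = frechet_derivative h (at y) w $ i"
      if "y \<in> S" "smooth_on S h" for h :: "'a \<Rightarrow> real ^ 'n" and y w
      using frechet_derivative_at[OF bounded_linear.has_derivative[OF bounded_linear_vec_nth smooth_on_has_derivative[OF that(2,1)]]]
      by metis
    have "frechet_derivative (\<lambda>y. frechet_derivative (\<lambda>y. f y $ i) (at y) u) (at x)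
        = frechet_derivative (\<lambda>y. frechet_derivative f (at y) u $ i) (at x)"
    proof (rule frechet_derivative_transform_within_open[OF _ S])
      show "(\<lambda>y. frechet_derivative (\<lambda>y. f y $ i) (at y) u) differentiable at x"
        using smooth_on_has_derivative[OF smooth_on_derivative[OF smooth_on_nth[OF S(1) f]] S(2)]
        unfolding differentiable_def by blast
    qed (use nth f in auto)
    then show ?thesis using nth[OF S(2) smooth_on_derivative[OF f]] by simp
  qed
  have "frechet_derivative (\<lambda>y. frechet_derivative (\<lambda>y. f y $ i) (at y) u) (at x) v
     = frechet_derivative (\<lambda>y. frechet_derivative (\<lambda>y. f y $ i) (at y) v) (at x) u" for i
  proof (rule tendsto_unique)
    show "((\<lambda>t. (f (x + t *\<^sub>R u + t *\<^sub>R v) $ i - f (x + t *\<^sub>R u) $ i - f (x + t *\<^sub>R v) $ i + f x $ i) / (t * t)) \<longlongrightarrow>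
        frechet_derivative (\<lambda>y. frechet_derivative (\<lambda>y. f y $ i) (at y) u) (at x) v) (at_right 0)"
      by (rule second_difference_tendsto[OF S smooth_on_nth[OF S(1) f]])
    have "((\<lambda>t. (f (x + t *\<^sub>R v + t *\<^sub>R u) $ i - f (x + t *\<^sub>R v) $ i - f (x + t *\<^sub>R u) $ i + f x $ i) / (t * t)) \<longlongrightarrow>
        frechet_derivative (\<lambda>y. frechet_derivative (\<lambda>y. f y $ i) (at y) v) (at x) u) (at_right 0)"
      by (rule second_difference_tendsto[OF S smooth_on_nth[OF S(1) f]])
    then show "((\<lambda>t. (f (x + t *\<^sub>R u + t *\<^sub>R v) $ i - f (x + t *\<^sub>R u) $ i - f (x + t *\<^sub>R v) $ i + f x $ i) / (t * t)) \<longlongrightarrow>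
        frechet_derivative (\<lambda>y. frechet_derivative (\<lambda>y. f y $ i) (at y) v) (at x) u) (at_right 0)"
      by (simp add: algebra_simps)
  qed simp
  then show ?thesis by (simp add: vec_eq_iff D)
qed

section \<open>Curvature in coordinates\<close>

lemma vec_axis_expand: "(\<Sum>i\<in>UNIV. x $ i *\<^sub>R axis i 1) = (x :: real ^ 'n)"
  using basis_expansion[of x] by (simp add: scalar_mult_eq_scaleR)

lemma det_eq_0_ker:
  fixes A :: "real ^ 'n ^ 'n"
  shows "det A = 0 \<longleftrightarrow> (\<exists>x. x \<noteq> 0 \<and> A *v x = 0)"
  using invertible_det_nz[of A] matrix_left_invertible_ker[of A] invertible_left_inverse[of A] by metis

lemma smooth_on_det:
  fixes A :: "'a::real_normed_vector \<Rightarrow> real ^ 'n ^ 'n"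
  assumes "open S" "\<And>i j. smooth_on S (\<lambda>x. A x $ i $ j)"
  shows "smooth_on S (\<lambda>x. det (A x))"
  unfolding det_def
  by (intro smooth_on_sum smooth_on_mult smooth_on_prod assms smooth_on_const)

text \<open>With \<open>G i j\<close> the column of Christoffel symbols with lower indices i and j,
  this is the zeroth-order term of the covariant derivative.\<close>

definition bil :: "('n \<Rightarrow> 'n \<Rightarrow> real ^ 'n) \<Rightarrow> real ^ 'n \<Rightarrow> real ^ 'n \<Rightarrow> real ^ 'n::finite" where
  "bil G u v = (\<Sum>i\<in>UNIV. \<Sum>j\<in>UNIV. (u $ i * v $ j) *\<^sub>R G i j)"

lemma bounded_bilinear_bil: "bounded_bilinear (bil G)"
  unfolding bilinear_conv_bounded_bilinear[symmetric] bilinear_def bil_def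
  by (auto intro!: linearI simp: algebra_simps sum.distrib scaleR_sum_right)

lemmas bil_simps =
  bounded_bilinear.add_left[OF bounded_bilinear_bil] bounded_bilinear.add_right[OF bounded_bilinear_bil]
  bounded_bilinear.diff_left[OF bounded_bilinear_bil] bounded_bilinear.diff_right[OF bounded_bilinear_bil]
  bounded_bilinear.scaleR_left[OF bounded_bilinear_bil] bounded_bilinear.scaleR_right[OF bounded_bilinear_bil]

lemma bil_scale: "bil (\<lambda>i j. a *\<^sub>R G i j) u v = a *\<^sub>R bil G u v"
  by (simp add: bil_def scaleR_sum_right mult.commute mult.left_commute)

lemma bil_axis: "bil G (axis i 1) (axis j 1) = G i j"
proof -
  have "bil G (axis i 1) (axis j 1) = (\<Sum>k\<in>UNIV. \<Sum>l\<in>UNIV. if l = j then (if k = i then G k l else 0) else 0)"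
    unfolding bil_def by (intro sum.cong) (auto simp: axis_def)
  then show ?thesis by simp
qed

lemma bil_has_derivative:
  assumes Y: "(Y has_derivative Y') (at x)" and Z: "(Z has_derivative Z') (at x)"
    and G: "\<And>i j. ((\<lambda>x. G x i j) has_derivative G' i j) (at x)"
  shows "((\<lambda>x. bil (G x) (Y x) (Z x)) has_derivative
    (\<lambda>h. bil (\<lambda>i j. G' i j h) (Y x) (Z x) + bil (G x) (Y' h) (Z x) + bil (G x) (Y x) (Z' h))) (at x)"
proof -
  note nth = bounded_linear.has_derivative[OF bounded_linear_vec_nth]
  show ?thesis
    unfolding bil_def
    by (rule derivative_eq_intros nth[OF Y] nth[OF Z] G refl)+
       (simp add: algebra_simps sum.distrib)
qed

section \<open>Covariant derivative and curvature of a connection in coordinates\<close>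

definition cov_deriv ::
    "(real ^ 'n \<Rightarrow> 'n \<Rightarrow> 'n \<Rightarrow> real ^ 'n) \<Rightarrow> (real ^ 'n \<Rightarrow> real ^ 'n) \<Rightarrow> (real ^ 'n \<Rightarrow> real ^ 'n) \<Rightarrow> real ^ 'n \<Rightarrow> real ^ 'n::finite" where
  "cov_deriv G Y Z x = frechet_derivative Z (at x) (Y x) + bil (G x) (Y x) (Z x)"

text \<open>\<open>R(u, v)w\<close> in coordinates, for the connection with Christoffel symbols \<open>G\<close>.\<close>

definition riem :: "(real ^ 'n \<Rightarrow> 'n \<Rightarrow> 'n \<Rightarrow> real ^ 'n) \<Rightarrow> real ^ 'n \<Rightarrow> real ^ 'n \<Rightarrow> real ^ 'n \<Rightarrow> real ^ 'n \<Rightarrow> real ^ 'n::finite" where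
  "riem G x u v w =
     bil (\<lambda>i j. frechet_derivative (\<lambda>x. G x i j) (at x) u) v w
   - bil (\<lambda>i j. frechet_derivative (\<lambda>x. G x i j) (at x) v) u w
   + bil (G x) u (bil (G x) v w) - bil (G x) v (bil (G x) u w)"

lemma linear_vec_expand:
  fixes f :: "real ^ 'n \<Rightarrow> 'b::real_vector"
  assumes "linear f"
  shows "f x = (\<Sum>i\<in>UNIV. x $ i *\<^sub>R f (axis i 1))"
  by (subst vec_axis_expand[symmetric]) (simp add: linear_sum[OF assms] linear_scale[OF assms])

text \<open>The direction of differentiation varies with the point, so a second term appears in
  which Y is differentiated.\<close>

lemma derivative_along_field:
  fixes Z :: "real ^ 'n \<Rightarrow> real ^ 'm" and Y :: "real ^ 'n \<Rightarrow> real ^ 'n"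
  assumes S: "open S" "x \<in> S" and YZ: "smooth_on S Y" "smooth_on S Z"
  shows "((\<lambda>y. frechet_derivative Z (at y) (Y y)) has_derivative
    (\<lambda>h. frechet_derivative (\<lambda>y. frechet_derivative Z (at y) (Y x)) (at x) h
       + frechet_derivative Z (at x) (frechet_derivative Y (at x) h))) (at x)"
proof -
  note dY = smooth_on_has_derivative[OF YZ(1) S(2)]
  have lin: "linear (frechet_derivative Z (at y))" if "y \<in> S" for y
    using has_derivative_linear[OF smooth_on_has_derivative[OF YZ(2) that]] .
  let ?dd = "\<lambda>v. frechet_derivative (\<lambda>y. frechet_derivative Z (at y) v) (at x)"
  have dZ: "((\<lambda>y. frechet_derivative Z (at y) v) has_derivative ?dd v) (at x)" for v
    by (rule smooth_on_has_derivative[OF smooth_on_derivative[OF YZ(2)] S(2)])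
  have "((\<lambda>y. \<Sum>i\<in>UNIV. v $ i *\<^sub>R frechet_derivative Z (at y) (axis i 1)) has_derivative
      (\<lambda>h. \<Sum>i\<in>UNIV. v $ i *\<^sub>R ?dd (axis i 1) h)) (at x)" for v
    by (intro has_derivative_sum has_derivative_scaleR_right dZ)
  then have "((\<lambda>y. frechet_derivative Z (at y) v) has_derivative
      (\<lambda>h. \<Sum>i\<in>UNIV. v $ i *\<^sub>R ?dd (axis i 1) h)) (at x)" for v
    by (rule has_derivative_transform_within_open[OF _ S]) (simp add: linear_vec_expand[OF lin])
  \<comment> \<open>Two derivatives of the same map coincide; this yields linearity of the second
    derivative in its inner direction v.\<close>
  then have dd: "?dd v = (\<lambda>h. \<Sum>i\<in>UNIV. v $ i *\<^sub>R ?dd (axis i 1) h)" for v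
    using has_derivative_unique[OF dZ] by blast
  have "((\<lambda>y. \<Sum>i\<in>UNIV. Y y $ i *\<^sub>R frechet_derivative Z (at y) (axis i 1)) has_derivative
      (\<lambda>h. \<Sum>i\<in>UNIV. Y x $ i *\<^sub>R ?dd (axis i 1) h
        + frechet_derivative Y (at x) h $ i *\<^sub>R frechet_derivative Z (at x) (axis i 1))) (at x)"
    by (intro has_derivative_sum has_derivative_scaleR bounded_linear.has_derivative[OF bounded_linear_vec_nth dY] dZ)
  then have "((\<lambda>y. frechet_derivative Z (at y) (Y y)) has_derivative
      (\<lambda>h. \<Sum>i\<in>UNIV. Y x $ i *\<^sub>R ?dd (axis i 1) h
        + frechet_derivative Y (at x) h $ i *\<^sub>R frechet_derivative Z (at x) (axis i 1))) (at x)"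
    by (rule has_derivative_transform_within_open[OF _ S]) (simp add: linear_vec_expand[OF lin])
  then show ?thesis
    by (simp add: sum.distrib fun_cong[OF dd[of "Y x"]] linear_vec_expand[OF lin[OF S(2)], of "frechet_derivative Y (at x) _"])
qed

text \<open>Second derivatives of Z cancel by symmetry, derivatives of X and Y cancel against the
  bracket, and first derivatives of Z cancel in pairs. Only the values of the fields at x survive,
  which is the tensoriality of the curvature.\<close>

lemma cov_deriv_commutator:
  assumes S: "open S" "x \<in> S" and XYZ: "smooth_on S X" "smooth_on S Y" "smooth_on S Z"
    and G: "\<And>i j. smooth_on S (\<lambda>x. G x i j)"
  shows "cov_deriv G X (cov_deriv G Y Z) x - cov_deriv G Y (cov_deriv G X Z) x
      - cov_deriv G (\<lambda>x. frechet_derivative Y (at x) (X x) - frechet_derivative X (at x) (Y x)) Z x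
    = riem G x (X x) (Y x) (Z x)"
proof -
  note d = smooth_on_has_derivative[OF _ S(2)]
  have cov: "frechet_derivative (cov_deriv G Y Z) (at x) h =
      frechet_derivative (\<lambda>y. frechet_derivative Z (at y) (Y x)) (at x) h
       + frechet_derivative Z (at x) (frechet_derivative Y (at x) h)
       + (bil (\<lambda>i j. frechet_derivative (\<lambda>x. G x i j) (at x) h) (Y x) (Z x)
       + bil (G x) (frechet_derivative Y (at x) h) (Z x) + bil (G x) (Y x) (frechet_derivative Z (at x) h))"
    if Y: "smooth_on S Y" for Y h
    unfolding cov_deriv_def[abs_def]
    by (rule fun_cong[OF frechet_derivative_at[symmetric],
          OF has_derivative_add[OF derivative_along_field[OF S Y XYZ(3)]
            bil_has_derivative[OF d[OF Y] d[OF XYZ(3)] d[OF G]]]])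
  show ?thesis
    using mixed_derivatives_commute[OF S XYZ(3), of "X x" "Y x"]
      linear_diff[OF has_derivative_linear[OF d[OF XYZ(3)]]]
    by (simp add: cov_deriv_def[of G X "cov_deriv G Y Z"] cov_deriv_def[of G Y "cov_deriv G X Z"] cov[OF XYZ(1)] cov[OF XYZ(2)]
        cov_deriv_def riem_def bil_simps)
qed

lemma cov_deriv_cong:
  assumes "open S" "x \<in> S" "Z differentiable at x" "\<And>y. y \<in> S \<Longrightarrow> Z y = Z' y" "Y x = Y' x"
  shows "cov_deriv G Y Z x = cov_deriv G Y' Z' x"
  using frechet_derivative_transform_within_open[OF assms(3,1,2,4)] assms(4)[OF assms(2)] assms(5)
  by (simp add: cov_deriv_def)

lemma riem_antisym: "riem G x v u w = - riem G x u v w"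
  by (simp add: riem_def)

lemma riem_linear_middle:
  assumes "\<And>i j. linear (frechet_derivative (\<lambda>x. G x i j) (at x))"
  shows "linear (\<lambda>v. riem G x u v w)"
proof -
  have "bil (\<lambda>i j. frechet_derivative (\<lambda>x. G x i j) (at x) (a + b)) u w
      = bil (\<lambda>i j. frechet_derivative (\<lambda>x. G x i j) (at x) a) u w + bil (\<lambda>i j. frechet_derivative (\<lambda>x. G x i j) (at x) b) u w"
    and "bil (\<lambda>i j. frechet_derivative (\<lambda>x. G x i j) (at x) (r *\<^sub>R a)) u w
      = r *\<^sub>R bil (\<lambda>i j. frechet_derivative (\<lambda>x. G x i j) (at x) a) u w" for a b r
    using assms by (simp_all add: linear_add linear_scale bil_def scaleR_add_right sum.distrib scaleR_sum_right mult_ac)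
  then show ?thesis
    by (intro linearI) (simp_all add: riem_def bil_simps scaleR_add_right scaleR_diff_right)
qed

lemma riem_linear_left:
  assumes "\<And>i j. linear (frechet_derivative (\<lambda>x. G x i j) (at x))"
  shows "linear (\<lambda>u. riem G x u v w)"
proof -
  have "linear (\<lambda>u. riem G x v u w)" by (rule riem_linear_middle[OF assms])
  from linear_compose_neg[OF this] show ?thesis by (subst riem_antisym) simp
qed

lemma riem_linear_right: "linear (\<lambda>w. riem G x u v w)"
  by (intro linearI) (simp_all add: riem_def bil_simps scaleR_add_right scaleR_diff_right)

text \<open>Invariance of the trace under a change of basis, later a change of chart: the cyclic
  property brings K and L together as K L, which is the identity.\<close>

lemma trace_conjugate:
  fixes L K T :: "real ^ 'n \<Rightarrow> real ^ 'n"
  assumes "linear L" "linear K" "linear T" and "\<And>v. K (L v) = v"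
  shows "(\<Sum>i\<in>UNIV. L (T (K (axis i 1))) $ i) = (\<Sum>i\<in>UNIV. T (axis i 1) $ i)"
proof -
  have tr: "(\<Sum>i\<in>UNIV. f (axis i 1) $ i) = trace (matrix f)" for f :: "real ^ 'n \<Rightarrow> real ^ 'n"
    by (simp add: trace_def matrix_def)
  have "K \<circ> L = id" using assms(4) by auto
  then have KL: "matrix K ** matrix L = mat 1"
    using matrix_compose[OF assms(1,2)] matrix_id_mat_1 by metis
  have "(\<Sum>i\<in>UNIV. L (T (K (axis i 1))) $ i) = trace (matrix (L \<circ> (T \<circ> K)))"
    by (simp add: tr[symmetric])
  also have "matrix (L \<circ> (T \<circ> K)) = matrix L ** (matrix T ** matrix K)"
    using assms(1-3) by (simp add: matrix_compose linear_compose)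
  also have "trace \<dots> = trace (matrix T ** (matrix K ** matrix L))"
    by (subst trace_mul_sym) (simp add: matrix_mul_assoc)
  finally show ?thesis by (simp add: KL tr)
qed

lemma matrix_inv_vector_mult:
  fixes A :: "real ^ 'n ^ 'n"
  assumes "det A \<noteq> 0"
  shows "matrix_inv A *v (A *v v) = v"
proof -
  have "\<exists>B. A ** B = mat 1 \<and> B ** A = mat 1"
    using assms invertible_det_nz unfolding invertible_def by blast
  then have "matrix_inv A ** A = mat 1" unfolding matrix_inv_def by (rule someI2_ex) simp
  then show ?thesis by (simp add: matrix_vector_mul_assoc)
qed

section \<open>Asymptotics of the curvature where the metric degenerates\<close>

text \<open>Replacing row l by the unit vector \<open>axis k 1\<close> yields the cofactor of entry
  (l, k) as a determinant of full size, so smoothness of the adjugate is inherited from that of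
  determinants.\<close>

definition adjugate :: "real ^ 'n ^ 'n \<Rightarrow> real ^ 'n ^ 'n::finite" where
  "adjugate A = (\<chi> k l. det (\<chi> i. if i = l then axis k 1 else A $ i))"

text \<open>By linearity of the determinant in row l, the sum is the determinant of A with row l
  replaced by row m: this is A itself if m = l, and a matrix with two equal rows otherwise.\<close>

lemma matrix_mult_adjugate: "(\<Sum>k\<in>UNIV. A $ m $ k * adjugate A $ k $ l) = (if m = l then det A else 0)"
proof -
  have "(\<Sum>k\<in>UNIV. A $ m $ k * adjugate A $ k $ l)
      = (\<Sum>k\<in>UNIV. det (\<chi> i. if i = l then A $ m $ k *s axis k 1 else A $ i))"
    by (simp add: adjugate_def det_row_mul)
  also have "\<dots> = det (\<chi> i. if i = l then (\<Sum>k\<in>UNIV. A $ m $ k *s axis k 1) else A $ i)"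
    by (rule det_linear_row_sum[symmetric]) simp
  also have "(\<Sum>k\<in>UNIV. A $ m $ k *s axis k 1) = A $ m" by (rule basis_expansion)
  also have "det (\<chi> i. if i = l then A $ m else A $ i) = (if m = l then det A else 0)"
  proof (cases "m = l")
    case True
    then have "(\<chi> i. if i = l then A $ m else A $ i) = A" by (simp add: vec_eq_iff)
    with True show ?thesis by simp
  next
    case False
    then have "det (\<chi> i. if i = l then A $ m else A $ i) = 0"
      by (intro det_identical_rows[of m l]) (auto simp: row_def vec_eq_iff)
    with False show ?thesis by simp
  qed
  finally show ?thesis .
qed

lemma smooth_on_adjugate:
  fixes A :: "'a::real_normed_vector \<Rightarrow> real ^ 'n ^ 'n"
  assumes "open S" "\<And>i j. smooth_on S (\<lambda>x. A x $ i $ j)"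
  shows "smooth_on S (\<lambda>x. adjugate (A x) $ k $ l)"
proof -
  have "smooth_on S (\<lambda>x. (\<chi> i. if i = l then axis k 1 else A x $ i) $ i $ j)" for i j
    using assms(2) by (cases "i = l") simp_all
  from smooth_on_det[OF assms(1) this] show ?thesis by (simp add: adjugate_def)
qed

text \<open>With B the adjugate, evaluating B^T A B in two ways gives the two entries, each
  multiplied by det A, which is then cancelled.\<close>

lemma adjugate_symmetric:
  assumes sym: "\<And>i j. A $ i $ j = A $ j $ i" and "det A \<noteq> 0"
  shows "adjugate A $ p $ q = adjugate A $ q $ p"
proof -
  let ?B = "adjugate A"
  have "det A * ?B $ q $ p = (\<Sum>m\<in>UNIV. ?B $ m $ p * (\<Sum>k\<in>UNIV. A $ m $ k * ?B $ k $ q))"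
    by (simp add: matrix_mult_adjugate if_distrib mult.commute cong: if_cong)
  also have "\<dots> = (\<Sum>k\<in>UNIV. ?B $ k $ q * (\<Sum>m\<in>UNIV. A $ k $ m * ?B $ m $ p))"
    unfolding sum_distrib_left by (subst sum.swap) (simp add: sym mult_ac)
  also have "\<dots> = det A * ?B $ p $ q"
    by (simp add: matrix_mult_adjugate if_distrib mult.commute cong: if_cong)
  finally show ?thesis using assms(2) by simp
qed

text \<open>Every column of the adjugate lies in the kernel of A. A nonzero cofactor makes A with
  row l replaced by a unit vector invertible, so a kernel vector is determined by its k-th
  coordinate and the columns are proportional. Symmetry then makes the rows proportional to the same
  vector.\<close>

lemma adjugate_rank_one:
  assumes det: "det A = 0" and nz: "adjugate A \<noteq> 0"
    and sym: "\<And>p q. adjugate A $ p $ q = adjugate A $ q $ p"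
  obtains r \<rho> where "r \<noteq> 0" "\<rho> \<noteq> 0" "A *v r = 0" "\<And>p q. adjugate A $ p $ q = \<rho> * r $ p * r $ q"
proof -
  let ?B = "adjugate A"
  obtain k l where kl: "?B $ k $ l \<noteq> 0" using nz by (auto simp: vec_eq_iff)
  define r where "r = column l ?B"
  have ker: "A *v column q ?B = 0" for q
    using matrix_mult_adjugate[of A _ q] det by (simp add: vec_eq_iff matrix_vector_mult_def column_def)
  have inj: "v = 0" if v: "A *v v = 0" "v $ k = 0" for v
  proof -
    have "(\<chi> i. if i = l then axis k 1 else A $ i) *v v = 0"
      unfolding vec_eq_iff
    proof
      fix i
      have "(A *v v) $ i = 0" using v(1) by simp
      then show "((\<chi> i. if i = l then axis k 1 else A $ i) *v v) $ i = 0 $ i"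
        using v(2) by (cases "i = l") (simp_all add: matrix_vector_mul_component inner_axis')
    qed
    then show "v = 0" using kl det_eq_0_ker unfolding adjugate_def by auto
  qed
  have rk: "r $ k \<noteq> 0" using kl by (simp add: r_def column_def)
  have col: "?B $ p $ q = (?B $ k $ q / r $ k) * r $ p" for p q
  proof -
    let ?v = "column q ?B - (?B $ k $ q / r $ k) *\<^sub>R r"
    have "A *v ?v = 0"
      using ker by (simp add: matrix_vector_mult_diff_distrib matrix_vector_mult_scaleR r_def)
    moreover have "?v $ k = 0" using rk by (simp add: column_def)
    ultimately have "?v = 0" by (rule inj)
    then have "?v $ p = 0" by simp
    then show ?thesis by (simp add: column_def)
  qed
  \<comment> \<open>By \<open>col\<close>, column q is r times the entry (k, q) divided by r_k.
    Symmetry and \<open>col\<close> for column k turn this coefficient into \<rho> r_q.\<close>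
  define \<rho> where "\<rho> = ?B $ k $ k / (r $ k)\<^sup>2"
  have B: "?B $ p $ q = \<rho> * r $ p * r $ q" for p q
    using col[of p q] col[of q k] sym[of k q] by (simp add: \<rho>_def power2_eq_square)
  show ?thesis
  proof
    show "r \<noteq> 0" using rk by auto
    show "\<rho> \<noteq> 0" using B[of k l] kl by auto
    show "A *v r = 0" using ker by (simp add: r_def)
  qed (rule B)
qed

text \<open>A degenerate point \<open>x0\<close> of a metric G in one coordinate system. The
  assumption \<open>tangent\<close> expresses that the radical is tangent to the zero set of the
  determinant; \<open>radical_derivative\<close> derives it from curves in the singular set.\<close>

context
  fixes S :: "(real ^ 'n::finite) set" and G :: "real ^ 'n \<Rightarrow> real ^ 'n ^ 'n" and x0 :: "real ^ 'n"
    and \<delta> d\<delta> reg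
  assumes S: "open S" "x0 \<in> S"
    and G: "\<And>i j. smooth_on S (\<lambda>x. G x $ i $ j)" "\<And>x i j. x \<in> S \<Longrightarrow> G x $ i $ j = G x $ j $ i"
  defines "\<delta> \<equiv> \<lambda>x. det (G x)"
  defines "d\<delta> \<equiv> frechet_derivative \<delta> (at x0)"
  defines "reg \<equiv> {x \<in> S. \<delta> x \<noteq> 0}"
  assumes \<delta>0: "\<delta> x0 = 0" and d\<delta>: "d\<delta> \<noteq> (\<lambda>_. 0)"
    and tangent: "\<And>r. G x0 *v r = 0 \<Longrightarrow> d\<delta> r = 0"
begin

lemma \<delta>_smooth: "smooth_on S \<delta>"
  unfolding \<delta>_def by (rule smooth_on_det[OF S(1) G(1)])

lemma \<delta>_derivative: "(\<delta> has_derivative d\<delta>) (at x0)"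
  unfolding d\<delta>_def by (rule smooth_on_has_derivative[OF \<delta>_smooth S(2)])

lemma open_reg: "open reg"
proof -
  have "open (S \<inter> \<delta> -` (- {0}))"
    by (rule continuous_open_preimage[OF smooth_on_continuous_on[OF \<delta>_smooth] S(1)]) auto
  also have "S \<inter> \<delta> -` (- {0}) = reg" by (auto simp: reg_def)
  finally show ?thesis .
qed

text \<open>If regular points did not accumulate at \<open>x0\<close>, the determinant would vanish
  near \<open>x0\<close>, and so would its derivative. Hence limits along \<open>reg\<close> are
  unique.\<close>

lemma at_reg_nontrivial: "at x0 within reg \<noteq> bot"
proof
  assume "at x0 within reg = bot"
  then obtain T where T: "open T" "x0 \<in> T" "\<And>y. y \<in> reg \<Longrightarrow> y \<in> T \<Longrightarrow> y = x0"
    unfolding trivial_limit_within islimpt_def by blast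
  have "((\<lambda>_. 0) has_derivative d\<delta>) (at x0)"
    by (rule has_derivative_transform_within_open[OF \<delta>_derivative, of "S \<inter> T"])
       (use S T \<delta>0 in \<open>auto simp: reg_def\<close>)
  then have "d\<delta> = (\<lambda>_. 0)" using has_derivative_unique has_derivative_const by blast
  with d\<delta> show False by blast
qed

lemma smooth_tendsto: "smooth_on S f \<Longrightarrow> (f \<longlongrightarrow> f x0) (at x0 within reg)"
  using smooth_on_continuous_on[of S f] S
  by (metis at_le continuous_on_eq_continuous_at isCont_def subset_UNIV tendsto_mono)

text \<open>The determinant vanishes at \<open>x0\<close>, so \<open>adjugate_symmetric\<close>
  applies only at nearby regular points and is carried over by continuity.\<close>

lemma adjugate_symmetric_x0: "adjugate (G x0) $ p $ q = adjugate (G x0) $ q $ p"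
proof (rule tendsto_unique[OF at_reg_nontrivial])
  show "((\<lambda>x. adjugate (G x) $ p $ q) \<longlongrightarrow> adjugate (G x0) $ p $ q) (at x0 within reg)" for p q
    by (rule smooth_tendsto[OF smooth_on_adjugate[OF S(1) G(1)]])
  then show "((\<lambda>x. adjugate (G x) $ p $ q) \<longlongrightarrow> adjugate (G x0) $ q $ p) (at x0 within reg)"
    by (rule Lim_transform_eventually)
       (auto simp: eventually_at_filter reg_def \<delta>_def intro!: eventuallyI adjugate_symmetric G(2))
qed

abbreviation "dG i x j k \<equiv> frechet_derivative (\<lambda>x. G x $ j $ k) (at x) (axis i 1)"

text \<open>Differentiate \<open>G * adjugate G = det G\<close> and contract with a vector of the kernel.\<close>

lemma kernel_derivative:
  assumes r: "G x0 *v r = 0"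
  shows "(\<Sum>m\<in>UNIV. (\<Sum>l\<in>UNIV. r $ l * frechet_derivative (\<lambda>x. G x $ l $ m) (at x0) h) * adjugate (G x0) $ m $ n)
    = d\<delta> h * r $ n"
proof -
  let ?d = "\<lambda>f. frechet_derivative f (at x0) h"
  note D = smooth_on_has_derivative[OF _ S(2)]
  have P: "((\<lambda>x. \<Sum>m\<in>UNIV. G x $ l $ m * adjugate (G x) $ m $ n) has_derivative
     (\<lambda>h. \<Sum>m\<in>UNIV. G x0 $ l $ m * frechet_derivative (\<lambda>x. adjugate (G x) $ m $ n) (at x0) h
        + frechet_derivative (\<lambda>x. G x $ l $ m) (at x0) h * adjugate (G x0) $ m $ n)) (at x0)" for l
    by (intro has_derivative_sum has_derivative_mult D[OF G(1)] D[OF smooth_on_adjugate[OF S(1) G(1)]])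
  have Q: "((\<lambda>x. \<Sum>m\<in>UNIV. G x $ l $ m * adjugate (G x) $ m $ n) has_derivative
      (\<lambda>h. if l = n then d\<delta> h else 0)) (at x0)" for l
    using \<delta>_derivative by (cases "l = n") (simp_all add: matrix_mult_adjugate \<delta>_def)
  have E: "(\<Sum>m\<in>UNIV. G x0 $ l $ m * ?d (\<lambda>x. adjugate (G x) $ m $ n)
        + ?d (\<lambda>x. G x $ l $ m) * adjugate (G x0) $ m $ n) = (if l = n then d\<delta> h else 0)" for l
    by (rule fun_cong[OF has_derivative_unique[OF P Q]])
  have ker: "(\<Sum>l\<in>UNIV. r $ l * G x0 $ l $ m) = 0" for m
    using arg_cong[OF r, of "\<lambda>v. v $ m"] G(2)[OF S(2), of m]
    by (simp add: matrix_vector_mult_def mult.commute)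
  have "d\<delta> h * r $ n = (\<Sum>l\<in>UNIV. r $ l * (if l = n then d\<delta> h else 0))"
    by (simp add: if_distrib mult.commute cong: if_cong)
  also have "\<dots> = (\<Sum>l\<in>UNIV. \<Sum>m\<in>UNIV. r $ l * G x0 $ l $ m * ?d (\<lambda>x. adjugate (G x) $ m $ n))
      + (\<Sum>l\<in>UNIV. \<Sum>m\<in>UNIV. r $ l * ?d (\<lambda>x. G x $ l $ m) * adjugate (G x0) $ m $ n)"
    unfolding E[symmetric] by (simp add: sum_distrib_left distrib_left sum.distrib mult.assoc)
  also have "(\<Sum>l\<in>UNIV. \<Sum>m\<in>UNIV. r $ l * G x0 $ l $ m * ?d (\<lambda>x. adjugate (G x) $ m $ n)) = 0"
    by (subst sum.swap) (simp add: sum_distrib_right[symmetric] ker)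
  finally have "d\<delta> h * r $ n = (\<Sum>l\<in>UNIV. \<Sum>m\<in>UNIV. r $ l * ?d (\<lambda>x. G x $ l $ m) * adjugate (G x0) $ m $ n)"
    by simp
  also have "\<dots> = (\<Sum>m\<in>UNIV. (\<Sum>l\<in>UNIV. r $ l * ?d (\<lambda>x. G x $ l $ m)) * adjugate (G x0) $ m $ n)"
    unfolding sum_distrib_right by (rule sum.swap)
  finally show ?thesis by simp
qed

text \<open>With a zero adjugate, \<open>kernel_derivative\<close> for a nonzero kernel vector would
  force d\<delta> = 0, against transversality.\<close>

lemma adjugate_nonzero: "adjugate (G x0) \<noteq> 0"
proof
  assume *: "adjugate (G x0) = 0"
  obtain r where r: "r \<noteq> 0" "G x0 *v r = 0" using \<delta>0 by (auto simp: \<delta>_def det_eq_0_ker)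
  then obtain n where "r $ n \<noteq> 0" by (auto simp: vec_eq_iff)
  with kernel_derivative[OF r(2), of _ n] * have "d\<delta> h = 0" for h by simp
  with d\<delta> show False by blast
qed

lemma radical_direction:
  obtains r \<rho> where "r \<noteq> 0" "\<rho> \<noteq> 0" "G x0 *v r = 0" "d\<delta> r = 0"
    "\<And>p q. adjugate (G x0) $ p $ q = \<rho> * r $ p * r $ q"
    "\<And>i. \<rho> * (\<Sum>l\<in>UNIV. \<Sum>m\<in>UNIV. r $ l * r $ m * dG i x0 l m) = d\<delta> (axis i 1)"
proof -
  obtain r \<rho> where r: "r \<noteq> 0" "\<rho> \<noteq> 0" "G x0 *v r = 0" "\<And>p q. adjugate (G x0) $ p $ q = \<rho> * r $ p * r $ q"
    using adjugate_rank_one[OF _ adjugate_nonzero adjugate_symmetric_x0] \<delta>0 by (auto simp: \<delta>_def)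
  obtain n where n: "r $ n \<noteq> 0" using r(1) by (auto simp: vec_eq_iff)
  have "\<rho> * (\<Sum>l\<in>UNIV. \<Sum>m\<in>UNIV. r $ l * r $ m * dG i x0 l m) = d\<delta> (axis i 1)" for i
  proof -
    \<comment> \<open>This is \<open>kernel_derivative\<close> with the rank-one form inserted; the
      common factor r_n is cancelled at the end.\<close>
    have "d\<delta> (axis i 1) * r $ n = (\<Sum>m\<in>UNIV. \<Sum>l\<in>UNIV. r $ l * dG i x0 l m * (\<rho> * r $ m * r $ n))"
      using kernel_derivative[OF r(3), of "axis i 1" n] by (simp add: r(4) sum_distrib_right)
    also have "\<dots> = \<rho> * (\<Sum>l\<in>UNIV. \<Sum>m\<in>UNIV. r $ l * r $ m * dG i x0 l m) * r $ n"
      by (subst sum.swap) (simp add: sum_distrib_left sum_distrib_right mult_ac)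
    finally show ?thesis using n by simp
  qed
  then show ?thesis using that r tangent by blast
qed

text \<open>The Christoffel symbols of the first kind; \<open>christoffel_koszul\<close> identifies
  them with g(D_i E_j, E_k) for the metric of a chart.\<close>

definition koszul :: "'n \<Rightarrow> 'n \<Rightarrow> 'n \<Rightarrow> real ^ 'n \<Rightarrow> real" where
  "koszul i j k x = (dG i x j k + dG j x i k - dG k x i j) / 2"

text \<open>By \<open>G\<Gamma> = koszul\<close>, this is \<open>\<delta>\<Gamma>\<close> where \<open>\<delta> \<noteq> 0\<close>.\<close>

definition regularized :: "real ^ 'n \<Rightarrow> 'n \<Rightarrow> 'n \<Rightarrow> real ^ 'n" where
  "regularized x i j = (\<chi> k. \<Sum>l\<in>UNIV. adjugate (G x) $ k $ l * koszul i j l x)"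

lemma regularized_smooth: "smooth_on S (\<lambda>x. regularized x i j)"
proof (rule smooth_on_vec[OF S(1)])
  have K: "smooth_on S (koszul i j l)" for l
    unfolding koszul_def[abs_def] divide_inverse
    by (intro smooth_on_mult smooth_on_diff smooth_on_add smooth_on_derivative S(1) G(1) smooth_on_const)
  show "smooth_on S (\<lambda>x. regularized x i j $ k)" for k
    unfolding regularized_def vec_lambda_beta
    by (intro smooth_on_sum smooth_on_mult smooth_on_adjugate S(1) G(1) K)
qed

text \<open>The result of substituting \<open>\<Gamma> = regularized / \<delta>\<close> in \<open>\<delta>\<^sup>2 riem \<Gamma>\<close>.\<close>

definition riem_regularized :: "real ^ 'n \<Rightarrow> real ^ 'n \<Rightarrow> real ^ 'n \<Rightarrow> real ^ 'n \<Rightarrow> real ^ 'n" where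
  "riem_regularized x u v w =
     \<delta> x *\<^sub>R bil (\<lambda>i j. frechet_derivative (\<lambda>x. regularized x i j) (at x) u) v w
   - frechet_derivative \<delta> (at x) u *\<^sub>R bil (regularized x) v w
   - \<delta> x *\<^sub>R bil (\<lambda>i j. frechet_derivative (\<lambda>x. regularized x i j) (at x) v) u w
   + frechet_derivative \<delta> (at x) v *\<^sub>R bil (regularized x) u w
   + bil (regularized x) u (bil (regularized x) v w) - bil (regularized x) v (bil (regularized x) u w)"

lemma riem_regularized_tendsto:
  "((\<lambda>x. riem_regularized x u v w) \<longlongrightarrow> riem_regularized x0 u v w) (at x0 within reg)"
  unfolding riem_regularized_def bil_def
  by (intro tendsto_intros smooth_tendsto smooth_on_derivative \<delta>_smooth regularized_smooth)

lemma trace_riem_regularized_x0: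
  "(\<Sum>k\<in>UNIV. riem_regularized x0 (axis a 1) (axis k 1) (axis a 1) $ k) = - (d\<delta> (axis a 1))\<^sup>2 / 4"
proof -
  obtain r \<rho> where r: "r \<noteq> 0" "\<rho> \<noteq> 0" "G x0 *v r = 0" "d\<delta> r = 0"
    "\<And>p q. adjugate (G x0) $ p $ q = \<rho> * r $ p * r $ q"
    "\<And>i. \<rho> * (\<Sum>l\<in>UNIV. \<Sum>m\<in>UNIV. r $ l * r $ m * dG i x0 l m) = d\<delta> (axis i 1)"
    by (rule radical_direction) blast
  have dG_sym: "dG i x0 j k = dG i x0 k j" for i j k
  proof -
    have "frechet_derivative (\<lambda>x. G x $ j $ k) (at x0) = frechet_derivative (\<lambda>x. G x $ k $ j) (at x0)"
    proof (rule frechet_derivative_transform_within_open[OF _ S])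
      show "(\<lambda>x. G x $ j $ k) differentiable at x0"
        unfolding differentiable_def using smooth_on_has_derivative[OF G(1) S(2)] by blast
    qed (rule G(2))
    then show ?thesis by simp
  qed
  \<comment> \<open>At \<open>x0\<close> the rank-one adjugate maps every column into the radical,
    so \<open>regularized\<close> is a scalar form times r.\<close>
  define \<beta> where "\<beta> i j = \<rho> * (\<Sum>l\<in>UNIV. r $ l * koszul i j l x0)" for i j
  have reg: "regularized x0 i j = \<beta> i j *\<^sub>R r" for i j
    by (simp add: vec_eq_iff regularized_def r(5) \<beta>_def sum_distrib_left sum_distrib_right mult_ac)
  have \<beta>_sym: "\<beta> i j = \<beta> j i" for i j
    using dG_sym by (simp add: \<beta>_def koszul_def add.commute)
  \<comment> \<open>After contraction with r in both j and l, the last two Koszul terms cancel. What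
    remains is half the derivative of G contracted with r twice, which \<open>r(6)\<close>
    evaluates.\<close>
  have \<beta>r: "(\<Sum>j\<in>UNIV. r $ j * \<beta> i j) = d\<delta> (axis i 1) / 2" for i
  proof -
    have "(\<Sum>j\<in>UNIV. r $ j * \<beta> i j) = \<rho> * (\<Sum>j\<in>UNIV. \<Sum>l\<in>UNIV. r $ j * r $ l * koszul i j l x0)"
      by (simp add: \<beta>_def sum_distrib_left mult_ac)
    also have "(\<Sum>j\<in>UNIV. \<Sum>l\<in>UNIV. r $ j * r $ l * koszul i j l x0) =
        ((\<Sum>j\<in>UNIV. \<Sum>l\<in>UNIV. r $ j * r $ l * dG i x0 j l)
        + (\<Sum>j\<in>UNIV. \<Sum>l\<in>UNIV. r $ j * r $ l * dG j x0 i l)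
        - (\<Sum>j\<in>UNIV. \<Sum>l\<in>UNIV. r $ j * r $ l * dG l x0 i j)) / 2"
      by (simp add: koszul_def sum.distrib sum_subtractf sum_divide_distrib distrib_left right_diff_distrib
          add_divide_distrib diff_divide_distrib)
    also have "(\<Sum>j\<in>UNIV. \<Sum>l\<in>UNIV. r $ j * r $ l * dG l x0 i j) = (\<Sum>j\<in>UNIV. \<Sum>l\<in>UNIV. r $ j * r $ l * dG j x0 i l)"
      by (subst sum.swap) (simp add: mult_ac)
    finally show ?thesis using r(6)[of i] by simp
  qed
  \<comment> \<open>This is d\<delta>(r) = 0, the tangency of the radical, written in
    coordinates.\<close>
  have d\<delta>r: "(\<Sum>k\<in>UNIV. r $ k * d\<delta> (axis k 1)) = 0"
    using linear_vec_expand[OF has_derivative_linear[OF \<delta>_derivative], of r] r(4) by simp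
  have bilr: "bil (regularized x0) (axis i 1) r = (d\<delta> (axis i 1) / 2) *\<^sub>R r" for i
  proof -
    have "bil (regularized x0) (axis i 1) r = (\<Sum>j\<in>UNIV. r $ j *\<^sub>R bil (regularized x0) (axis i 1) (axis j 1))"
      by (rule linear_vec_expand[OF bounded_linear.linear[OF bounded_bilinear.bounded_linear_right[OF bounded_bilinear_bil]]])
    also have "\<dots> = (\<Sum>j\<in>UNIV. r $ j * \<beta> i j) *\<^sub>R r" by (simp add: bil_axis reg scaleR_sum_left)
    finally show ?thesis by (simp add: \<beta>r)
  qed
  let ?d = "\<lambda>i. d\<delta> (axis i 1)"
  \<comment> \<open>The terms with d\<delta> contribute \<open>\<beta> a a * ?d k\<close> and
    \<open>- ?d a * \<beta> a k\<close>, both times r_k; the quadratic terms take back half of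
    each.\<close>
  have "riem_regularized x0 (axis a 1) (axis k 1) (axis a 1) $ k =
      \<beta> a a / 2 * (r $ k * ?d k) - ?d a / 2 * (r $ k * \<beta> a k)" for k
    by (simp add: riem_regularized_def \<delta>0 d\<delta>_def[symmetric] bil_axis reg bil_simps bilr \<beta>_sym[of k a] mult_ac)
  then have "(\<Sum>k\<in>UNIV. riem_regularized x0 (axis a 1) (axis k 1) (axis a 1) $ k)
      = \<beta> a a / 2 * (\<Sum>k\<in>UNIV. r $ k * ?d k) - ?d a / 2 * (\<Sum>k\<in>UNIV. r $ k * \<beta> a k)"
    by (simp only: sum_subtractf sum_distrib_left)
  then show ?thesis by (simp add: \<beta>r d\<delta>r power2_eq_square)
qed

text \<open>Writing Q for \<open>regularized\<close>, the relation Q = \<delta> \<Gamma> gives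
  \<delta>^2 d\<Gamma> = \<delta> dQ - d\<delta> Q, and in the quadratic terms each \<Gamma> absorbs
  one factor \<delta>.\<close>

lemma scaled_riem:
  assumes \<Gamma>: "\<And>i j. smooth_on reg (\<lambda>x. \<Gamma> x i j)"
    and K: "\<And>x i j k. x \<in> reg \<Longrightarrow> (G x *v \<Gamma> x i j) $ k = koszul i j k x"
    and x: "x \<in> reg"
  shows "(\<delta> x)\<^sup>2 *\<^sub>R riem \<Gamma> x u v w = riem_regularized x u v w"
proof -
  have Q: "regularized y i j = \<delta> y *\<^sub>R \<Gamma> y i j" if y: "y \<in> reg" for y i j
    unfolding vec_eq_iff
  proof
    fix k
    have yS: "y \<in> S" "det (G y) \<noteq> 0" using y by (auto simp: reg_def \<delta>_def)
    \<comment> \<open>Transposing the adjugate brings the sum into the form G * adjugate G, to which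
      \<open>matrix_mult_adjugate\<close> applies.\<close>
    have B: "adjugate (G y) $ k $ l = adjugate (G y) $ l $ k" for l
      by (rule adjugate_symmetric[OF G(2)[OF yS(1)] yS(2)])
    have "regularized y i j $ k = (\<Sum>l\<in>UNIV. adjugate (G y) $ l $ k * (\<Sum>m\<in>UNIV. G y $ l $ m * \<Gamma> y i j $ m))"
      unfolding regularized_def vec_lambda_beta K[OF y, symmetric] B by (simp add: matrix_vector_mult_def)
    also have "\<dots> = (\<Sum>m\<in>UNIV. (\<Sum>l\<in>UNIV. G y $ m $ l * adjugate (G y) $ l $ k) * \<Gamma> y i j $ m)"
      unfolding sum_distrib_left sum_distrib_right
      by (subst sum.swap) (simp add: G(2)[OF yS(1), of _ "_"] mult_ac)
    also have "\<dots> = (\<Sum>m\<in>UNIV. if m = k then \<delta> y * \<Gamma> y i j $ m else 0)"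
      by (intro sum.cong) (simp_all add: matrix_mult_adjugate \<delta>_def)
    also have "\<dots> = \<delta> y * \<Gamma> y i j $ k" by simp
    finally show "regularized y i j $ k = (\<delta> y *\<^sub>R \<Gamma> y i j) $ k" by simp
  qed
  have xS: "x \<in> S" using x by (simp add: reg_def)
  have dQ: "frechet_derivative (\<lambda>x. regularized x i j) (at x) h =
      \<delta> x *\<^sub>R frechet_derivative (\<lambda>x. \<Gamma> x i j) (at x) h + frechet_derivative \<delta> (at x) h *\<^sub>R \<Gamma> x i j" for i j h
  proof -
    have "((\<lambda>x. \<delta> x *\<^sub>R \<Gamma> x i j) has_derivative (\<lambda>h. \<delta> x *\<^sub>R frechet_derivative (\<lambda>x. \<Gamma> x i j) (at x) h
        + frechet_derivative \<delta> (at x) h *\<^sub>R \<Gamma> x i j)) (at x)"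
      by (intro has_derivative_scaleR smooth_on_has_derivative[OF \<delta>_smooth xS] smooth_on_has_derivative[OF \<Gamma> x])
    then have "((\<lambda>x. regularized x i j) has_derivative (\<lambda>h. \<delta> x *\<^sub>R frechet_derivative (\<lambda>x. \<Gamma> x i j) (at x) h
        + frechet_derivative \<delta> (at x) h *\<^sub>R \<Gamma> x i j)) (at x)"
      by (rule has_derivative_transform_within_open[OF _ open_reg x]) (simp add: Q)
    then show ?thesis by (rule fun_cong[OF frechet_derivative_at[symmetric]])
  qed
  define d\<Gamma> where "d\<Gamma> h i j = frechet_derivative (\<lambda>x. \<Gamma> x i j) (at x) h" for h i j
  have bQ: "bil (regularized x) u v = \<delta> x *\<^sub>R bil (\<Gamma> x) u v" for u v
    using bil_scale[of "\<delta> x" "\<Gamma> x" u v] by (simp add: Q[OF x, abs_def])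
  have bdQ: "bil (\<lambda>i j. frechet_derivative (\<lambda>x. regularized x i j) (at x) h) u v
      = \<delta> x *\<^sub>R bil (d\<Gamma> h) u v + frechet_derivative \<delta> (at x) h *\<^sub>R bil (\<Gamma> x) u v" for h u v
    unfolding dQ by (simp add: bil_def d\<Gamma>_def scaleR_sum_right scaleR_add_right sum.distrib mult_ac)
  show ?thesis
    unfolding riem_regularized_def bdQ bQ riem_def d\<Gamma>_def[symmetric]
    by (simp add: bil_simps d\<Gamma>_def[symmetric] algebra_simps power2_eq_square)
qed

lemma ricci_limit:
  assumes \<Gamma>: "\<And>i j. smooth_on reg (\<lambda>x. \<Gamma> x i j)"
    and K: "\<And>x i j k. x \<in> reg \<Longrightarrow> (G x *v \<Gamma> x i j) $ k = (dG i x j k + dG j x i k - dG k x i j) / 2"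
  shows "((\<lambda>x. (\<delta> x)\<^sup>2 * (\<Sum>k\<in>UNIV. riem \<Gamma> x (axis a 1) (axis k 1) (axis a 1) $ k)) \<longlongrightarrow>
    - (d\<delta> (axis a 1))\<^sup>2 / 4) (at x0 within reg)"
proof -
  have lim: "((\<lambda>x. \<Sum>k\<in>UNIV. riem_regularized x (axis a 1) (axis k 1) (axis a 1) $ k) \<longlongrightarrow>
      - (d\<delta> (axis a 1))\<^sup>2 / 4) (at x0 within reg)"
    unfolding trace_riem_regularized_x0[symmetric] by (intro tendsto_intros riem_regularized_tendsto)
  have eq: "(\<Sum>k\<in>UNIV. riem_regularized x (axis a 1) (axis k 1) (axis a 1) $ k)
      = (\<delta> x)\<^sup>2 * (\<Sum>k\<in>UNIV. riem \<Gamma> x (axis a 1) (axis k 1) (axis a 1) $ k)" if "x \<in> reg" for x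
    using scaled_riem[OF \<Gamma> K[folded koszul_def] that, symmetric] by (simp add: sum_distrib_left)
  show ?thesis
    by (rule Lim_transform_eventually[OF lim]) (unfold eventually_at_filter, intro eventuallyI impI eq)
qed

end

section \<open>Charts and vector fields\<close>

context smooth_manifold
begin

lemma charts_at_iff: "c \<in> charts_at p \<longleftrightarrow> c \<in> atlas \<and> p \<in> fst c"
  by (simp add: charts_at_def)

lemma chart_domain:
  assumes "c \<in> atlas"
  shows "open (fst c)" "fst c \<subseteq> M" "open (snd c ` fst c)"
  using charts[OF assms] cover assms by (auto simp: is_chart_def)

lemma chart_homeomorphism: "c \<in> atlas \<Longrightarrow> homeomorphism (fst c) (snd c ` fst c) (snd c) (cinv c)"
  using charts by (simp add: is_chart_def)

lemma cinv_snd [simp]: "c \<in> atlas \<Longrightarrow> p \<in> fst c \<Longrightarrow> cinv c (snd c p) = p"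
  using chart_homeomorphism homeomorphism_apply1 by blast

lemma open_chart_image:
  assumes "c \<in> atlas" "open V"
  shows "open (snd c ` (fst c \<inter> V))"
proof -
  have "open (snd c ` fst c \<inter> cinv c -` V)"
    using chart_domain(3)[OF assms(1)] homeomorphism_cont2[OF chart_homeomorphism[OF assms(1)]] assms(2)
    by (intro continuous_open_preimage)
  moreover have "snd c ` fst c \<inter> cinv c -` V = snd c ` (fst c \<inter> V)"
    using assms(1) by (auto simp: image_iff)
  ultimately show ?thesis by simp
qed

lemma open_chart_overlap: "c \<in> atlas \<Longrightarrow> c' \<in> atlas \<Longrightarrow> open (snd c ` (fst c \<inter> fst c'))"
  by (simp add: open_chart_image chart_domain)

lemma transition_smooth:
  "c \<in> atlas \<Longrightarrow> c' \<in> atlas \<Longrightarrow> smooth_on (snd c ` (fst c \<inter> fst c')) (\<lambda>x. snd c' (cinv c x))"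
  using compat[of c c'] by (simp add: compatible_def comp_def)

lemma transition_derivative:
  assumes "c \<in> charts_at p" "c' \<in> charts_at p"
  shows "((\<lambda>x. snd c' (cinv c x)) has_derivative jac c c' p) (at (snd c p))"
  unfolding jac_def comp_def
  by (rule smooth_on_has_derivative[OF transition_smooth[of c c']]) (use assms in \<open>auto simp: charts_at_iff\<close>)

lemma jac_linear: "c \<in> charts_at p \<Longrightarrow> c' \<in> charts_at p \<Longrightarrow> bounded_linear (jac c c' p)"
  using transition_derivative has_derivative_bounded_linear by blast

lemma jac_eqI: "((\<lambda>x. snd c' (cinv c x)) has_derivative f') (at (snd c p)) \<Longrightarrow> jac c c' p = f'"
  unfolding jac_def comp_def by (rule frechet_derivative_at[symmetric])

lemma jac_comp:
  assumes "c \<in> charts_at p" "c' \<in> charts_at p" "c'' \<in> charts_at p"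
  shows "jac c' c'' p (jac c c' p v) = jac c c'' p v"
proof -
  have A: "c \<in> atlas" "c' \<in> atlas" "p \<in> fst c" "p \<in> fst c'" using assms by (auto simp: charts_at_iff)
  have "((\<lambda>x. snd c'' (cinv c' (snd c' (cinv c x)))) has_derivative (\<lambda>v. jac c' c'' p (jac c c' p v))) (at (snd c p))"
    by (rule has_derivative_compose[OF transition_derivative[OF assms(1,2)]])
       (use transition_derivative[OF assms(2,3)] A in simp)
  then have "((\<lambda>x. snd c'' (cinv c x)) has_derivative (\<lambda>v. jac c' c'' p (jac c c' p v))) (at (snd c p))"
    by (rule has_derivative_transform_within_open[OF _ open_chart_overlap[OF A(1,2)]]) (use A in auto)
  from fun_cong[OF jac_eqI[OF this], of v] show ?thesis by simp
qed

lemma jac_self: "c \<in> charts_at p \<Longrightarrow> jac c c p v = v"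
proof -
  assume c: "c \<in> charts_at p"
  then have A: "c \<in> atlas" "p \<in> fst c" by (auto simp: charts_at_iff)
  have "((\<lambda>x. snd c (cinv c x)) has_derivative (\<lambda>v. v)) (at (snd c p))"
    by (rule has_derivative_transform_within_open[OF has_derivative_ident chart_domain(3)[OF A(1)]]) (use A in auto)
  from fun_cong[OF jac_eqI[OF this], of v] show ?thesis by simp
qed

lemma tangent_jac: "v \<in> tangent p \<Longrightarrow> c \<in> charts_at p \<Longrightarrow> c' \<in> charts_at p \<Longrightarrow> v c' = jac c c' p (v c)"
  unfolding tangent_def by blast

lemma tangent_off: "v \<in> tangent p \<Longrightarrow> c \<notin> charts_at p \<Longrightarrow> v c = 0"
  unfolding tangent_def by blast

lemma tangentI:
  assumes "\<And>c c'. c \<in> charts_at p \<Longrightarrow> c' \<in> charts_at p \<Longrightarrow> jac c c' p (v c) = v c'"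
    and "\<And>c. c \<notin> charts_at p \<Longrightarrow> v c = 0"
  shows "v \<in> tangent p"
  unfolding tangent_def using assms by (intro CollectI) metis

lemma tangent_eqI:
  assumes "u \<in> tangent p" "v \<in> tangent p" "c \<in> charts_at p" "u c = v c"
  shows "u = v"
proof
  fix c' show "u c' = v c'"
    using tangent_jac[OF assms(1,3)] tangent_jac[OF assms(2,3)] tangent_off[OF assms(1)] tangent_off[OF assms(2)]
      assms(4) by metis
qed

lemma tangent_add:
  assumes "u \<in> tangent p" "v \<in> tangent p"
  shows "(\<lambda>c. u c + v c) \<in> tangent p"
proof (rule tangentI)
  fix c c' assume c: "c \<in> charts_at p" "c' \<in> charts_at p"
  show "jac c c' p (u c + v c) = u c' + v c'"
    by (simp add: linear_simps(1)[OF jac_linear[OF c]] tangent_jac[OF assms(1) c] tangent_jac[OF assms(2) c])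
qed (simp add: tangent_off[OF assms(1)] tangent_off[OF assms(2)])

lemma tangent_scaleR:
  assumes "u \<in> tangent p"
  shows "(\<lambda>c. a *\<^sub>R u c) \<in> tangent p"
proof (rule tangentI)
  fix c c' assume c: "c \<in> charts_at p" "c' \<in> charts_at p"
  show "jac c c' p (a *\<^sub>R u c) = a *\<^sub>R u c'"
    by (simp add: linear_simps(5)[OF jac_linear[OF c]] tangent_jac[OF assms c])
qed (simp add: tangent_off[OF assms])

lemma tangent_zero: "(\<lambda>c. 0) \<in> tangent p"
  by (rule tangentI) (simp_all add: linear_simps(3)[OF jac_linear])

lemma tangent_diff: "u \<in> tangent p \<Longrightarrow> v \<in> tangent p \<Longrightarrow> (\<lambda>c. u c - v c) \<in> tangent p"
  using tangent_add[of u p "\<lambda>c. (- 1) *\<^sub>R v c"] tangent_scaleR[of v p "- 1"] by simp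

lemma tangent_sum:
  "(\<And>i. i \<in> I \<Longrightarrow> u i \<in> tangent p) \<Longrightarrow> (\<lambda>c. \<Sum>i\<in>I. u i c) \<in> tangent p"
  by (induction I rule: infinite_finite_induct) (auto simp: tangent_zero tangent_add)

definition lift :: "('a, 'n) chart \<Rightarrow> 'a \<Rightarrow> real ^ 'n \<Rightarrow> ('a, 'n) tvec" where
  "lift c p v = (\<lambda>c'. if c' \<in> charts_at p then jac c c' p v else 0)"

lemma lift_tangent: "c \<in> charts_at p \<Longrightarrow> lift c p v \<in> tangent p"
  by (rule tangentI) (auto simp: lift_def jac_comp)

lemma lift_self: "c \<in> charts_at p \<Longrightarrow> lift c p v c = v"
  by (simp add: lift_def jac_self)

lemma coord_eq_lift: "coord c i p = lift c p (axis i 1)"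
  by (simp add: coord_def lift_def)

lemma coord_tangent: "c \<in> charts_at p \<Longrightarrow> coord c i p \<in> tangent p"
  by (simp add: coord_eq_lift lift_tangent)

lemma coord_self: "c \<in> charts_at p \<Longrightarrow> coord c i p c = axis i 1"
  by (simp add: coord_eq_lift lift_self)

lemma tangent_expand:
  assumes "v \<in> tangent p" "c \<in> charts_at p"
  shows "v = (\<lambda>c'. \<Sum>i\<in>UNIV. v c $ i *\<^sub>R coord c i p c')"
  by (rule tangent_eqI[OF assms(1) tangent_sum[OF tangent_scaleR[OF coord_tangent]] assms(2)])
     (use assms in \<open>simp_all add: coord_self vec_axis_expand\<close>)

lemma smooth_change_chart:
  assumes c: "c \<in> atlas" "c' \<in> atlas" and W: "open W" "W \<subseteq> fst c"
    and h: "smooth_on (snd c ` W) (\<lambda>x. h (cinv c x))"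
  shows "smooth_on (snd c' ` (fst c' \<inter> W)) (\<lambda>x. h (cinv c' x))"
proof -
  have "smooth_on (snd c' ` (fst c' \<inter> W)) (\<lambda>x. h (cinv c (snd c (cinv c' x))))"
  proof (rule smooth_on_compose[OF _ _ _ _ h])
    show "open (snd c' ` (fst c' \<inter> W))" using open_chart_image c W by blast
    show "open (snd c ` W)" using open_chart_image[OF c(1) W(1)] W(2) by (simp add: Int_absorb1)
    show "(\<lambda>x. snd c (cinv c' x)) ` snd c' ` (fst c' \<inter> W) \<subseteq> snd c ` W"
      using c(2) by (auto simp: image_iff)
    show "smooth_on (snd c' ` (fst c' \<inter> W)) (\<lambda>x. snd c (cinv c' x))"
      by (rule smooth_on_subset[OF transition_smooth[OF c(2,1)]]) (use W in auto)
  qed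
  then show ?thesis
    by (rule smooth_on_cong[THEN iffD1, rotated -1]) (use c W open_chart_image in auto)
qed

lemma smooth_fun_chartI:
  assumes "c \<in> atlas" "open W" "W \<subseteq> fst c" "smooth_on (snd c ` W) (\<lambda>x. f (cinv c x))"
  shows "smooth_fun W f"
  using smooth_change_chart[OF assms(1) _ assms(2-4)] by (simp add: smooth_fun_def comp_def)

lemma smooth_funD:
  "smooth_fun W f \<Longrightarrow> c \<in> atlas \<Longrightarrow> smooth_on (snd c ` (fst c \<inter> W)) (\<lambda>x. f (cinv c x))"
  by (simp add: smooth_fun_def comp_def)

lemma vector_fieldsD:
  assumes "X \<in> vector_fields W"
  shows "p \<in> W \<Longrightarrow> X p \<in> tangent p"
    and "c \<in> atlas \<Longrightarrow> smooth_on (snd c ` (fst c \<inter> W)) (\<lambda>x. X (cinv c x) c)"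
  using assms by (auto simp: vector_fields_def)

text \<open>On an overlap the column in another chart is the Jacobian applied to the column in c,
  and the columns of the Jacobian are directional derivatives of a smooth transition map. So
  smoothness in one chart containing W gives it in all charts.\<close>

lemma vector_fields_chartI:
  assumes c: "c \<in> atlas" and W: "open W" "W \<subseteq> fst c"
    and X: "\<And>p. p \<in> W \<Longrightarrow> X p \<in> tangent p" "smooth_on (snd c ` W) (\<lambda>x. X (cinv c x) c)"
  shows "X \<in> vector_fields W"
  unfolding vector_fields_def
proof (intro CollectI conjI ballI)
  fix c' assume c': "c' \<in> atlas"
  let ?S = "snd c' ` (fst c' \<inter> W)"
  have S: "open ?S" using open_chart_image c' W by blast
  have J: "smooth_on ?S (\<lambda>x. jac c c' (cinv c' x) (axis i 1))" for i
  proof -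
    have "smooth_on (snd c ` (fst c' \<inter> W)) (\<lambda>x. frechet_derivative (\<lambda>x. snd c' (cinv c x)) (at x) (axis i 1))"
      by (rule smooth_on_derivative, rule smooth_on_subset[OF transition_smooth[OF c c']]) (use W in auto)
    then have "smooth_on (snd c ` (fst c' \<inter> W)) (\<lambda>x. jac c c' (cinv c x) (axis i 1))"
      by (rule smooth_on_cong[THEN iffD1, rotated -1])
         (use open_chart_image[OF c, of "fst c' \<inter> W"] chart_domain[OF c'] W c in
           \<open>auto simp: jac_def comp_def Int_absorb1 le_infI2 subset_iff\<close>)
    then show ?thesis
      using smooth_change_chart[OF c c', of "fst c' \<inter> W" "\<lambda>p. jac c c' p (axis i 1)"] W chart_domain[OF c']
      by (auto simp: Int_absorb1 le_infI2 simp flip: Int_assoc)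
  qed
  have V: "smooth_on ?S (\<lambda>x. X (cinv c' x) c)"
    by (rule smooth_change_chart[OF c c' W, of "\<lambda>p. X p c"]) (rule X(2))
  have "smooth_on ?S (\<lambda>x. \<Sum>i\<in>UNIV. X (cinv c' x) c $ i *\<^sub>R jac c c' (cinv c' x) (axis i 1))"
    by (intro smooth_on_sum smooth_on_scaleR S J smooth_on_nth V)
  then show "smooth_on ?S (\<lambda>x. X (cinv c' x) c')"
  proof (rule smooth_on_cong[THEN iffD1, rotated -1])
    fix x assume "x \<in> ?S"
    then have p: "cinv c' x \<in> W" "c' \<in> charts_at (cinv c' x)" "c \<in> charts_at (cinv c' x)"
      using c c' W by (auto simp: charts_at_iff)
    show "(\<Sum>i\<in>UNIV. X (cinv c' x) c $ i *\<^sub>R jac c c' (cinv c' x) (axis i 1)) = X (cinv c' x) c'"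
      using fun_cong[OF tangent_expand[OF X(1)[OF p(1)] p(3)], of c'] p by (simp add: coord_def)
  qed (rule S)
qed (rule X(1))

lemma vector_fields_subset: "X \<in> vector_fields W \<Longrightarrow> W' \<subseteq> W \<Longrightarrow> X \<in> vector_fields W'"
  unfolding vector_fields_def by (fastforce intro: smooth_on_subset)

lemma vector_fields_add:
  assumes "open W" "X \<in> vector_fields W" "Y \<in> vector_fields W"
  shows "(\<lambda>p c. X p c + Y p c) \<in> vector_fields W"
  using assms open_chart_image tangent_add by (auto simp: vector_fields_def intro!: smooth_on_add)

lemma vector_fields_diff:
  assumes "open W" "X \<in> vector_fields W" "Y \<in> vector_fields W"
  shows "(\<lambda>p c. X p c - Y p c) \<in> vector_fields W"
  using assms open_chart_image tangent_diff by (auto simp: vector_fields_def intro!: smooth_on_diff)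

lemma vector_fields_scaleR:
  assumes "open W" "X \<in> vector_fields W" "smooth_fun W f"
  shows "(\<lambda>p c. f p *\<^sub>R X p c) \<in> vector_fields W"
  using assms open_chart_image tangent_scaleR
  by (auto simp: vector_fields_def smooth_fun_def comp_def intro!: smooth_on_scaleR)

lemma vector_fields_zero: "(\<lambda>p c. 0) \<in> vector_fields W"
  by (simp add: vector_fields_def tangent_zero)

lemma vector_fields_cong:
  assumes "open W" "X \<in> vector_fields W" "\<And>p. p \<in> W \<Longrightarrow> X p = Y p"
  shows "Y \<in> vector_fields W"
  unfolding vector_fields_def
proof (intro CollectI conjI ballI)
  show "Y p \<in> tangent p" if "p \<in> W" for p using assms that vector_fieldsD(1) by metis
  fix c assume c: "c \<in> atlas"
  show "smooth_on (snd c ` (fst c \<inter> W)) (\<lambda>x. Y (cinv c x) c)"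
    by (rule smooth_on_cong[THEN iffD1, OF _ _ vector_fieldsD(2)[OF assms(2) c]])
       (use c assms open_chart_image in auto)
qed

lemma coord_vector_field: "c \<in> atlas \<Longrightarrow> coord c i \<in> vector_fields (fst c)"
proof (rule vector_fields_chartI)
  assume c: "c \<in> atlas"
  show "smooth_on (snd c ` fst c) (\<lambda>x. coord c i (cinv c x) c)"
    by (rule smooth_on_cong[THEN iffD2, OF _ _ smooth_on_const])
       (use c chart_domain in \<open>auto simp: coord_self charts_at_iff\<close>)
qed (auto simp: chart_domain coord_tangent charts_at_iff)

lemma component_smooth_fun:
  assumes "c \<in> atlas" "open W" "W \<subseteq> fst c" "X \<in> vector_fields W"
  shows "smooth_fun W (\<lambda>p. X p c $ i)"
  using vector_fieldsD(2)[OF assms(4,1)] open_chart_image[OF assms(1,2)] assms(3)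
  by (intro smooth_fun_chartI[OF assms(1-3)] smooth_on_nth) (auto simp: Int_absorb1)

text \<open>The chart domain and the complement of K are open, cover the manifold, and carry smooth
  restrictions of the field. This globalises a field cut off by a bump function.\<close>

lemma vector_fields_extend_zero:
  assumes c: "c \<in> atlas" and K: "closed K" "K \<subseteq> fst c"
    and X: "X \<in> vector_fields (fst c)" "\<And>p. p \<notin> K \<Longrightarrow> X p = (\<lambda>_. 0)"
  shows "X \<in> vector_fields M"
  unfolding vector_fields_def
proof (intro CollectI conjI ballI)
  fix p show "X p \<in> tangent p"
    using K X vector_fieldsD(1)[OF X(1), of p] tangent_zero[of p] by (cases "p \<in> K") auto
next
  fix c' assume c': "c' \<in> atlas"
  have 1: "smooth_on (snd c' ` (fst c' \<inter> fst c)) (\<lambda>x. X (cinv c' x) c')"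
    using vector_fieldsD(2)[OF X(1) c'] .
  have 2: "smooth_on (snd c' ` (fst c' \<inter> - K)) (\<lambda>x. X (cinv c' x) c')"
    by (rule smooth_on_cong[THEN iffD1, OF _ _ smooth_on_const[of _ 0]])
       (use open_chart_image[OF c', of "- K"] c' K X(2) in auto)
  show "smooth_on (snd c' ` (fst c' \<inter> M)) (\<lambda>x. X (cinv c' x) c')"
    by (rule smooth_on_subset[OF smooth_on_Un[OF _ _ 1 2]])
       (use open_chart_image[OF c', of "- K"] open_chart_overlap[OF c' c] K in auto)
qed

text \<open>The chart in \<open>dir\<close> is picked by choice. The chain rule through the
  transition map matches the Jacobian rule for tangent vectors, so any chart around p gives the same
  value.\<close>

lemma dir_chart:
  assumes p: "c \<in> charts_at p" and v: "v \<in> tangent p"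
    and f: "((\<lambda>x. f (cinv c x)) has_derivative f') (at (snd c p))"
  shows "dir v f p = f' (v c)"
proof -
  define c0 where "c0 = (SOME c. c \<in> charts_at p)"
  have c0: "c0 \<in> charts_at p" unfolding c0_def using p by (rule someI)
  have A: "c \<in> atlas" "c0 \<in> atlas" "p \<in> fst c" "p \<in> fst c0" using p c0 by (auto simp: charts_at_iff)
  have "((\<lambda>x. f (cinv c (snd c (cinv c0 x)))) has_derivative (\<lambda>v. f' (jac c0 c p v))) (at (snd c0 p))"
    by (rule has_derivative_compose[OF transition_derivative[OF c0 p]]) (use A f in simp)
  then have "((\<lambda>x. f (cinv c0 x)) has_derivative (\<lambda>v. f' (jac c0 c p v))) (at (snd c0 p))"
    by (rule has_derivative_transform_within_open[OF _ open_chart_overlap[OF A(2,1)]]) (use A in auto)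
  from frechet_derivative_at[OF this, symmetric]
  show ?thesis
    using tangent_jac[OF v c0 p] by (simp add: dir_def c0_def[symmetric] comp_def)
qed

end

section \<open>The metric in a chart\<close>

context metric_manifold
begin

lemma charts_at_M: "c \<in> charts_at p \<Longrightarrow> p \<in> M"
  unfolding charts_at_iff using chart_domain(2) by blast

lemma g_zero: "p \<in> M \<Longrightarrow> w \<in> tangent p \<Longrightarrow> g p (\<lambda>c. 0) w = 0"
  using g_linear[of p "\<lambda>c. 0" "\<lambda>c. 0" w 1] tangent_zero[of p] by simp

lemma g_sum:
  assumes "p \<in> M" "w \<in> tangent p" "\<And>i. i \<in> I \<Longrightarrow> u i \<in> tangent p"
  shows "g p (\<lambda>c. \<Sum>i\<in>I. a i *\<^sub>R u i c) w = (\<Sum>i\<in>I. a i * g p (u i) w)"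
  using assms(3)
proof (induction I rule: infinite_finite_induct)
  case (insert i I)
  then show ?case
    using g_linear[OF assms(1), of "u i" "\<lambda>c. \<Sum>i\<in>I. a i *\<^sub>R u i c" w "a i"] assms(2)
    by (simp add: tangent_sum tangent_scaleR)
qed (use assms in \<open>simp_all add: g_zero\<close>)

lemma gram_sym: "c \<in> charts_at p \<Longrightarrow> gram c p $ i $ j = gram c p $ j $ i"
  using g_sym[OF charts_at_M coord_tangent coord_tangent] by (simp add: gram_def)

lemma g_chart:
  assumes c: "c \<in> charts_at p" and uv: "u \<in> tangent p" "v \<in> tangent p"
  shows "g p u v = (gram c p *v u c) \<bullet> v c"
proof -
  have p: "p \<in> M" and E: "coord c i p \<in> tangent p" for i using c charts_at_M coord_tangent by auto
  have gj: "g p (coord c j p) v = (\<Sum>i\<in>UNIV. v c $ i * gram c p $ i $ j)" for j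
  proof -
    have "g p (coord c j p) v = g p v (coord c j p)" by (rule g_sym[OF p E uv(2)])
    also have "\<dots> = g p (\<lambda>c'. \<Sum>i\<in>UNIV. v c $ i *\<^sub>R coord c i p c') (coord c j p)"
      using tangent_expand[OF uv(2) c] by simp
    also have "\<dots> = (\<Sum>i\<in>UNIV. v c $ i * g p (coord c i p) (coord c j p))" by (rule g_sum[OF p E E])
    finally show ?thesis by (simp add: gram_def)
  qed
  have "g p u v = g p (\<lambda>c'. \<Sum>j\<in>UNIV. u c $ j *\<^sub>R coord c j p c') v"
    using tangent_expand[OF uv(1) c] by simp
  also have "\<dots> = (\<Sum>j\<in>UNIV. u c $ j * g p (coord c j p) v)" by (rule g_sum[OF p uv(2) E])
  finally show ?thesis
    unfolding inner_vec_def matrix_vector_mult_def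
    by (simp add: gj sum_distrib_left sum_distrib_right mult_ac) (rule sum.swap)
qed

lemma radical_chart:
  assumes c: "c \<in> charts_at p" and v: "v \<in> tangent p"
  shows "v \<in> radical p \<longleftrightarrow> gram c p *v v c = 0"
proof
  assume "v \<in> radical p"
  then have "g p v (lift c p (gram c p *v v c)) = 0"
    using lift_tangent[OF c] by (simp add: radical_def)
  then show "gram c p *v v c = 0"
    using g_chart[OF c v lift_tangent[OF c]] lift_self[OF c] by simp
next
  assume "gram c p *v v c = 0"
  then show "v \<in> radical p" using v g_chart[OF c v] by (simp add: radical_def)
qed

text \<open>The radical is defined without charts, so the vanishing of the determinant does not
  depend on the chart. Membership in \<open>sing\<close>, which asks for some chart, can then be
  tested in any.\<close>

lemma det_gram_0_iff:
  assumes c: "c \<in> charts_at p"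
  shows "det (gram c p) = 0 \<longleftrightarrow> radical p \<noteq> {\<lambda>_. 0}"
proof -
  have "det (gram c p) = 0 \<longleftrightarrow> (\<exists>v\<in>radical p. v \<noteq> (\<lambda>_. 0))"
  proof
    assume "det (gram c p) = 0"
    then obtain x where x: "x \<noteq> 0" "gram c p *v x = 0" by (auto simp: det_eq_0_ker)
    then show "\<exists>v\<in>radical p. v \<noteq> (\<lambda>_. 0)"
      using radical_chart[OF c lift_tangent[OF c], of x] lift_self[OF c, of x]
      by (intro bexI[of _ "lift c p x"]) auto
  next
    assume "\<exists>v\<in>radical p. v \<noteq> (\<lambda>_. 0)"
    then obtain v where v: "v \<in> radical p" "v \<noteq> (\<lambda>_. 0)" by blast
    then have t: "v \<in> tangent p" by (simp add: radical_def)
    have "v c \<noteq> 0" using tangent_eqI[OF t tangent_zero c] v(2) by auto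
    then show "det (gram c p) = 0" using radical_chart[OF c t] v(1) by (auto simp: det_eq_0_ker)
  qed
  moreover have "(\<lambda>_. 0) \<in> radical p" using radical_chart[OF c tangent_zero] by simp
  ultimately show ?thesis by blast
qed

lemma sing_iff: "c \<in> charts_at p \<Longrightarrow> p \<in> sing \<longleftrightarrow> det (gram c p) = 0"
  using det_gram_0_iff charts_at_M det_eq_0_rank unfolding sing_def by blast

lemma gram_smooth: "c \<in> atlas \<Longrightarrow> smooth_on (snd c ` fst c) (\<lambda>x. gram c (cinv c x) $ i $ j)"
  using smooth_funD[OF g_smooth[of c i j], of c] by (simp add: gram_def)

lemma det_gram_smooth: "c \<in> atlas \<Longrightarrow> smooth_on (snd c ` fst c) (\<lambda>x. det (gram c (cinv c x)))"
  by (intro smooth_on_det gram_smooth chart_domain)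

lemma open_chart_diff_sing:
  assumes c: "c \<in> atlas"
  shows "open (fst c - sing)"
proof -
  have "continuous_on (fst c) (\<lambda>p. det (gram c (cinv c (snd c p))))"
    using continuous_on_compose2[OF smooth_on_continuous_on[OF det_gram_smooth[OF c]]
        homeomorphism_cont1[OF chart_homeomorphism[OF c]]] by auto
  then have "continuous_on (fst c) (\<lambda>p. det (gram c p))"
    by (rule continuous_on_cong[THEN iffD1, rotated -1]) (use c in auto)
  then have "open (fst c \<inter> (\<lambda>p. det (gram c p)) -` (- {0}))"
    by (rule continuous_open_preimage) (use chart_domain[OF c] in auto)
  moreover have "fst c \<inter> (\<lambda>p. det (gram c p)) -` (- {0}) = fst c - sing"
    using sing_iff[of c] c by (auto simp: charts_at_iff)
  ultimately show ?thesis by simp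
qed

end

section \<open>The Levi-Civita connection and its curvature in a chart\<close>

context metric_manifold
begin

context
  fixes D :: "('a, 'n) connection"
  assumes levi_civita: "levi_civita D"
begin

lemmas levi_civita_on = levi_civita[unfolded levi_civita_def, THEN spec, THEN mp, OF conjI]

lemma D_vector_field:
  "open W \<Longrightarrow> W \<subseteq> M - sing \<Longrightarrow> X \<in> vector_fields W \<Longrightarrow> Y \<in> vector_fields W \<Longrightarrow> D X Y \<in> vector_fields W"
  by (rule levi_civita_on[THEN conjunct1, rule_format])

lemma
  assumes "open W" "W \<subseteq> M - sing" "X \<in> vector_fields W" "Y \<in> vector_fields W" "Z \<in> vector_fields W" "p \<in> W"
  shows D_add_left: "D (\<lambda>q c. X q c + Y q c) Z p = (\<lambda>c. D X Z p c + D Y Z p c)"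
    and D_add_right: "D X (\<lambda>q c. Y q c + Z q c) p = (\<lambda>c. D X Y p c + D X Z p c)"
    and D_torsion: "D X Y p = (\<lambda>c. D Y X p c + lie X Y p c)"
    and D_metric: "dir (X p) (ip Y Z) p = ip (D X Y) Z p + ip Y (D X Z) p"
  by (rule levi_civita_on[THEN conjunct2, THEN conjunct1, rule_format, THEN conjunct1, OF assms],
      rule levi_civita_on[THEN conjunct2, THEN conjunct1, rule_format, THEN conjunct2, THEN conjunct1, OF assms],
      rule levi_civita_on[THEN conjunct2, THEN conjunct1, rule_format, THEN conjunct2, THEN conjunct2, THEN conjunct1, OF assms],
      rule levi_civita_on[THEN conjunct2, THEN conjunct1, rule_format, THEN conjunct2, THEN conjunct2, THEN conjunct2, OF assms])

lemma
  assumes "open W" "W \<subseteq> M - sing" "X \<in> vector_fields W" "Y \<in> vector_fields W" "smooth_fun W f" "p \<in> W"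
  shows D_scaleR_left: "D (\<lambda>q c. f q *\<^sub>R X q c) Y p = (\<lambda>c. f p *\<^sub>R D X Y p c)"
    and D_scaleR_right: "D X (\<lambda>q c. f q *\<^sub>R Y q c) p = (\<lambda>c. dir (X p) f p *\<^sub>R Y p c + f p *\<^sub>R D X Y p c)"
  by (rule levi_civita_on[THEN conjunct2, THEN conjunct2, rule_format, THEN conjunct1, OF assms],
      rule levi_civita_on[THEN conjunct2, THEN conjunct2, rule_format, THEN conjunct2, OF assms])

lemma smooth_fun_indicator:
  assumes "open W"
  shows "smooth_fun W (\<lambda>q. if q \<in> W then 1 else 0)"
  unfolding smooth_fun_def comp_def
proof
  fix c assume c: "c \<in> atlas"
  show "smooth_on (snd c ` (fst c \<inter> W)) (\<lambda>x. if cinv c x \<in> W then 1 else 0)"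
    by (rule smooth_on_cong[THEN iffD1, OF open_chart_image[OF c assms] _ smooth_on_const[of _ 1]]) (use c in auto)
qed

text \<open>Multiplying by the indicator function of \<open>W\<close>, which is smooth on \<open>W\<close>, makes two fields that
  agree on \<open>W\<close> equal.\<close>

lemma D_cong:
  assumes W: "open W" "W \<subseteq> M - sing" and X: "X \<in> vector_fields W" "X' \<in> vector_fields W"
    and Y: "Y \<in> vector_fields W" "Y' \<in> vector_fields W"
    and eq: "\<And>q. q \<in> W \<Longrightarrow> X q = X' q" "\<And>q. q \<in> W \<Longrightarrow> Y q = Y' q" and p: "p \<in> W"
  shows "D X Y p = D X' Y' p"
proof -
  let ?f = "\<lambda>q. if q \<in> W then 1 else 0 :: real"
  note f = smooth_fun_indicator[OF W(1)]
  have "(\<lambda>q c. ?f q *\<^sub>R X q c) = (\<lambda>q c. ?f q *\<^sub>R X' q c)" using eq by (auto simp: fun_eq_iff)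
  then have "D X Y p = D X' Y p"
    using D_scaleR_left[OF W X(1) Y(1) f p] D_scaleR_left[OF W X(2) Y(1) f p] p by simp
  moreover have e: "(\<lambda>q c. ?f q *\<^sub>R Y q c) = (\<lambda>q c. ?f q *\<^sub>R Y' q c)" using eq by (auto simp: fun_eq_iff)
  \<comment> \<open>The Leibniz rule adds a \<open>dir\<close> term on both sides; these terms agree
    because Y p = Y' p, and so they cancel.\<close>
  have "D X' Y p c = D X' Y' p c" for c
    using fun_cong[OF D_scaleR_right[OF W X(2) Y(1) f p], of c] fun_cong[OF D_scaleR_right[OF W X(2) Y(2) f p], of c]
      p eq(2)[OF p] by (simp add: e)
  then have "D X' Y p = D X' Y' p" by (rule ext)
  ultimately show ?thesis by simp
qed

lemma D_zero:
  assumes W: "open W" "W \<subseteq> M - sing" and X: "X \<in> vector_fields W" and p: "p \<in> W"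
  shows "D (\<lambda>q c. 0) X p = (\<lambda>c. 0)" "D X (\<lambda>q c. 0) p = (\<lambda>c. 0)"
  using D_add_left[OF W vector_fields_zero vector_fields_zero X p]
    D_add_right[OF W X vector_fields_zero vector_fields_zero p] by (auto simp: fun_eq_iff)

lemma vector_fields_sum:
  assumes "open W" "\<And>i. i \<in> I \<Longrightarrow> Z i \<in> vector_fields W"
  shows "(\<lambda>q c. \<Sum>i\<in>I. Z i q c) \<in> vector_fields W"
  using assms(2)
  by (induction I rule: infinite_finite_induct) (auto simp: vector_fields_zero intro!: vector_fields_add assms(1))

lemma D_sum_left:
  assumes W: "open W" "W \<subseteq> M - sing" and X: "X \<in> vector_fields W" and p: "p \<in> W"
    and Z: "\<And>i. i \<in> I \<Longrightarrow> Z i \<in> vector_fields W"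
  shows "D (\<lambda>q c. \<Sum>i\<in>I. Z i q c) X p = (\<lambda>c. \<Sum>i\<in>I. D (Z i) X p c)"
  using Z
proof (induction I rule: infinite_finite_induct)
  case (insert i I)
  then show ?case
    using D_add_left[OF W _ vector_fields_sum[OF W(1)] X p, of "Z i" I Z] by simp
qed (simp_all add: D_zero(1)[OF W X p])

lemma D_sum_right:
  assumes W: "open W" "W \<subseteq> M - sing" and X: "X \<in> vector_fields W" and p: "p \<in> W"
    and Z: "\<And>i. i \<in> I \<Longrightarrow> Z i \<in> vector_fields W"
  shows "D X (\<lambda>q c. \<Sum>i\<in>I. Z i q c) p = (\<lambda>c. \<Sum>i\<in>I. D X (Z i) p c)"
  using Z
proof (induction I rule: infinite_finite_induct)
  case (insert i I)
  then show ?case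
    using D_add_right[OF W X _ vector_fields_sum[OF W(1)] p, of "Z i" I Z] by simp
qed (simp_all add: D_zero(2)[OF W X p])

definition christoffel :: "('a, 'n) chart \<Rightarrow> real ^ 'n \<Rightarrow> 'n \<Rightarrow> 'n \<Rightarrow> real ^ 'n" where
  "christoffel c x i j = D (coord c i) (coord c j) (cinv c x) c"

lemma christoffel_smooth:
  assumes c: "c \<in> atlas"
  shows "smooth_on (snd c ` (fst c - sing)) (\<lambda>x. christoffel c x i j)"
proof -
  have E: "coord c i \<in> vector_fields (fst c - sing)" for i
    using vector_fields_subset[OF coord_vector_field[OF c]] by blast
  have "D (coord c i) (coord c j) \<in> vector_fields (fst c - sing)"
    by (rule D_vector_field[OF open_chart_diff_sing[OF c] _ E E]) (use chart_domain(2)[OF c] in blast)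
  from vector_fieldsD(2)[OF this c] show ?thesis
    by (simp add: christoffel_def Int_absorb1)
qed

text \<open>D is given only by its algebraic rules, so both fields are expanded in the coordinate
  frame. Additivity and function-linearity treat X, the Leibniz rule treats Y, and its derivative
  terms add up to the Frechet derivative of the column of Y.\<close>

lemma D_chart:
  assumes c: "c \<in> atlas" and W: "open W" "W \<subseteq> fst c - sing"
    and X: "X \<in> vector_fields W" and Y: "Y \<in> vector_fields W" and p: "p \<in> W"
  shows "D X Y p c = cov_deriv (christoffel c) (\<lambda>x. X (cinv c x) c) (\<lambda>x. Y (cinv c x) c) (snd c p)"
proof -
  have W': "W \<subseteq> M - sing" "W \<subseteq> fst c" using W chart_domain(2)[OF c] by auto
  have cp: "c \<in> charts_at p" using c p W' by (auto simp: charts_at_iff)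
  have E: "coord c i \<in> vector_fields W" for i
    using vector_fields_subset[OF coord_vector_field[OF c] W'(2)] .
  let ?dY = "frechet_derivative (\<lambda>x. Y (cinv c x) c) (at (snd c p))"
  have dY: "((\<lambda>x. Y (cinv c x) c) has_derivative ?dY) (at (snd c p))"
    by (rule smooth_on_has_derivative[OF vector_fieldsD(2)[OF Y c]]) (use p W' in auto)
  have comp: "smooth_fun W (\<lambda>p. Z p c $ i)" if "Z \<in> vector_fields W" for Z i
    by (rule component_smooth_fun[OF c W(1) W'(2) that])
  have EX: "(\<lambda>q c'. Z q c $ i *\<^sub>R coord c i q c') \<in> vector_fields W" if "Z \<in> vector_fields W" for Z i
    by (rule vector_fields_scaleR[OF W(1) E comp[OF that]])
  have ex: "Z q = (\<lambda>c'. \<Sum>i\<in>UNIV. Z q c $ i *\<^sub>R coord c i q c')" if "Z \<in> vector_fields W" "q \<in> W" for Z q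
    by (rule tangent_expand[OF vector_fieldsD(1)[OF that]]) (use that W' c in \<open>auto simp: charts_at_iff\<close>)
  have 1: "D (coord c i) Y p c = (\<Sum>j\<in>UNIV. ?dY (axis i 1) $ j *\<^sub>R axis j 1 + Y p c $ j *\<^sub>R christoffel c (snd c p) i j)" for i
  proof -
    have dirY: "dir (coord c i p) (\<lambda>q. Y q c $ j) p = ?dY (coord c i p c) $ j" for j
      by (rule dir_chart[OF cp coord_tangent[OF cp] bounded_linear.has_derivative[OF bounded_linear_vec_nth dY]])
    have "D (coord c i) Y p c = D (coord c i) (\<lambda>q c'. \<Sum>j\<in>UNIV. Y q c $ j *\<^sub>R coord c j q c') p c"
      by (rule fun_cong[OF D_cong[OF W(1) W'(1) E E Y vector_fields_sum[OF W(1) EX[OF Y]] refl ex[OF Y] p]])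
    also have "\<dots> = (\<Sum>j\<in>UNIV. D (coord c i) (\<lambda>q c'. Y q c $ j *\<^sub>R coord c j q c') p c)"
      by (simp add: D_sum_right[OF W(1) W'(1) E p EX[OF Y]])
    also have "\<dots> = (\<Sum>j\<in>UNIV. dir (coord c i p) (\<lambda>q. Y q c $ j) p *\<^sub>R coord c j p c + Y p c $ j *\<^sub>R D (coord c i) (coord c j) p c)"
      by (simp add: D_scaleR_right[OF W(1) W'(1) E E comp[OF Y] p])
    finally show ?thesis
      using c p W' by (simp add: dirY coord_self[OF cp] christoffel_def subset_iff)
  qed
  have "D X Y p c = D (\<lambda>q c'. \<Sum>i\<in>UNIV. X q c $ i *\<^sub>R coord c i q c') Y p c"
    by (rule fun_cong[OF D_cong[OF W(1) W'(1) X vector_fields_sum[OF W(1) EX[OF X]] Y Y ex[OF X] refl p]])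
  also have "\<dots> = (\<Sum>i\<in>UNIV. X p c $ i *\<^sub>R D (coord c i) Y p c)"
    by (simp add: D_sum_left[OF W(1) W'(1) Y p EX[OF X]] D_scaleR_left[OF W(1) W'(1) E Y comp[OF X] p])
  also have "\<dots> = (\<Sum>i\<in>UNIV. X p c $ i *\<^sub>R ?dY (axis i 1))
      + (\<Sum>i\<in>UNIV. \<Sum>j\<in>UNIV. (X p c $ i * Y p c $ j) *\<^sub>R christoffel c (snd c p) i j)"
    by (simp add: 1 sum.distrib vec_axis_expand scaleR_add_right scaleR_sum_right)
  also have "(\<Sum>i\<in>UNIV. X p c $ i *\<^sub>R ?dY (axis i 1)) = ?dY (\<Sum>i\<in>UNIV. X p c $ i *\<^sub>R axis i 1)"
    using has_derivative_linear[OF dY] by (simp add: linear_sum linear_scale)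
  finally show ?thesis
    using c p W' by (simp add: vec_axis_expand cov_deriv_def bil_def subset_iff)
qed

text \<open>Coordinate fields commute, so \<open>a\<close> is symmetric in i and j. Metric
  compatibility gives \<open>\<delta> i j k = a i j k + a i k j\<close>, and the usual cyclic
  combination isolates \<open>a i j k\<close>. In this lemma \<delta> stands for partial derivatives
  of the Gram matrix, not for its determinant.\<close>

lemma christoffel_koszul:
  assumes c: "c \<in> atlas" and p: "p \<in> fst c - sing"
  defines "\<delta> \<equiv> \<lambda>i j k. frechet_derivative (\<lambda>x. gram c (cinv c x) $ j $ k) (at (snd c p)) (axis i 1)"
  shows "(gram c p *v christoffel c (snd c p) i j) $ k = (\<delta> i j k + \<delta> j i k - \<delta> k i j) / 2"
proof -
  let ?W = "fst c - sing"
  have W: "open ?W" "?W \<subseteq> M - sing" using open_chart_diff_sing[OF c] chart_domain(2)[OF c] by auto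
  have cp: "c \<in> charts_at p" using c p by (auto simp: charts_at_iff)
  have E: "coord c i \<in> vector_fields ?W" for i
    using vector_fields_subset[OF coord_vector_field[OF c]] by blast
  have DT: "D (coord c i) (coord c j) p \<in> tangent p" for i j
    using vector_fieldsD(1)[OF D_vector_field[OF W E E] p] .
  note ET = coord_tangent[OF cp]
  define a where "a i j k = (gram c p *v christoffel c (snd c p) i j) $ k" for i j k
  have a: "g p (D (coord c i) (coord c j) p) (coord c k p) = a i j k" for i j k
    using c p by (simp add: g_chart[OF cp DT ET] coord_self[OF cp] a_def christoffel_def inner_axis)
  have "D (coord c i) (coord c j) p c = D (coord c j) (coord c i) p c + lie (coord c i) (coord c j) p c" for i j
    by (rule fun_cong[OF D_torsion[OF W E E E p, of i j]])
  moreover have "lie (coord c i) (coord c j) p c = 0" for i j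
  proof -
    have "frechet_derivative (\<lambda>x. coord c k (cinv c x) c) (at (snd c p)) = (\<lambda>_. 0)" for k
      by (rule frechet_derivative_at[symmetric],
          rule has_derivative_transform_within_open[OF has_derivative_const[of "axis k 1"] chart_domain(3)[OF c]])
         (use c p in \<open>auto simp: coord_self charts_at_iff\<close>)
    then show ?thesis by (simp add: lie_def)
  qed
  ultimately have sym: "a i j k = a j i k" for i j k
    using c p by (simp add: a_def christoffel_def)
  have "dir (coord c i p) (ip (coord c j) (coord c k)) p = \<delta> i j k" for i j k
  proof -
    have "((\<lambda>x. ip (coord c j) (coord c k) (cinv c x)) has_derivative
        frechet_derivative (\<lambda>x. gram c (cinv c x) $ j $ k) (at (snd c p))) (at (snd c p))"
      using smooth_on_has_derivative[OF gram_smooth[OF c]] p by (auto simp: gram_def ip_def)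
    from dir_chart[OF cp ET this] show ?thesis by (simp add: coord_self[OF cp] \<delta>_def)
  qed
  moreover have "g p (coord c j p) (D (coord c i) (coord c k) p) = a i k j" for i j k
    using g_sym[OF charts_at_M[OF cp] ET DT] a by metis
  ultimately have "\<delta> i j k = a i j k + a i k j" for i j k
    using D_metric[OF W E E E p, of i j k] by (simp add: ip_def a)
  then show ?thesis using sym[of i j k] sym[of i k j] sym[of j k i] by (simp add: a_def[symmetric])
qed

text \<open>Torsion-freeness expresses the bracket as D X Y - D Y X, which is smooth and tangent by
  the axioms for D; this replaces a computation with Jacobians.\<close>

lemma lie_vector_field:
  assumes W: "open W" "W \<subseteq> M - sing" and X: "X \<in> vector_fields W" and Y: "Y \<in> vector_fields W"
  shows "lie X Y \<in> vector_fields W"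
  by (rule vector_fields_cong[OF W(1) vector_fields_diff[OF W(1) D_vector_field[OF W X Y] D_vector_field[OF W Y X]]])
     (use D_torsion[OF W X Y Y] in simp)

lemma curv_tangent:
  assumes W: "open W" "W \<subseteq> M - sing" and X: "X \<in> vector_fields W" and Y: "Y \<in> vector_fields W"
    and Z: "Z \<in> vector_fields W" and p: "p \<in> W"
  shows "curv D X Y Z p \<in> tangent p"
  unfolding curv_def
  by (intro tangent_diff vector_fieldsD(1)[OF _ p] D_vector_field[OF W] lie_vector_field[OF W] X Y Z)

lemma curv_chart:
  assumes c: "c \<in> atlas" and W: "open W" "W \<subseteq> fst c - sing"
    and X: "X \<in> vector_fields W" and Y: "Y \<in> vector_fields W" and Z: "Z \<in> vector_fields W" and p: "p \<in> W"
  shows "curv D X Y Z p c = riem (christoffel c) (snd c p) (X p c) (Y p c) (Z p c)"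
proof -
  have W': "W \<subseteq> M - sing" "W \<subseteq> fst c" using W chart_domain(2)[OF c] by auto
  let ?S = "snd c ` W" and ?x = "snd c p" and ?G = "christoffel c"
  define h where "h V x = V (cinv c x) c" for V :: "('a, 'n) vfield" and x
  have S: "open ?S" using open_chart_image[OF c W(1)] W'(2) by (simp add: Int_absorb1)
  have x: "?x \<in> ?S" and px: "cinv c ?x = p" "c \<in> charts_at p"
    using p W' c by (auto simp: charts_at_iff)
  have sm: "smooth_on ?S (h V)" if "V \<in> vector_fields W" for V
    using vector_fieldsD(2)[OF that c] W'(2) by (simp add: h_def[abs_def] Int_absorb1)
  have G: "smooth_on ?S (\<lambda>x. ?G x i j)" for i j
    by (rule smooth_on_subset[OF christoffel_smooth[OF c]]) (use W in auto)
  have D1: "D U V q c = cov_deriv ?G (h U) (h V) (snd c q)"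
    if "U \<in> vector_fields W" "V \<in> vector_fields W" "q \<in> W" for U V q
    using D_chart[OF c W that] by (simp add: h_def[abs_def])
  note DV = D_vector_field[OF W(1) W'(1)]
  \<comment> \<open>The outer derivative differentiates the inner one, so the coordinate expression
    of the latter is needed on all of W and not just at p.\<close>
  have D2: "D U (D V Z) p c = cov_deriv ?G (h U) (cov_deriv ?G (h V) (h Z)) ?x"
    if U: "U \<in> vector_fields W" and V: "V \<in> vector_fields W" for U V
    unfolding D1[OF U DV[OF V Z] p]
  proof (rule cov_deriv_cong[OF S x])
    show "h (D V Z) differentiable at ?x"
      using smooth_on_has_derivative[OF sm[OF DV[OF V Z]] x] unfolding differentiable_def by blast
    show "h (D V Z) y = cov_deriv ?G (h V) (h Z) y" if "y \<in> ?S" for y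
      using that D1[OF V Z] c W' by (auto simp: h_def[of "D V Z"])
  qed simp
  have D3: "D (lie X Y) Z p c = cov_deriv ?G
      (\<lambda>x. frechet_derivative (h Y) (at x) (h X x) - frechet_derivative (h X) (at x) (h Y x)) (h Z) ?x"
    unfolding D1[OF lie_vector_field[OF W(1) W'(1) X Y] Z p]
    using px by (simp add: cov_deriv_def h_def[abs_def] lie_def)
  show ?thesis
    using cov_deriv_commutator[OF S x sm[OF X] sm[OF Y] sm[OF Z] G] px(1)
    by (simp add: curv_def D2[OF X Y] D2[OF Y X] D3 h_def[of _ ?x])
qed

lemma christoffel_derivative_linear:
  assumes "c \<in> atlas" "p \<in> fst c - sing"
  shows "linear (frechet_derivative (\<lambda>x. christoffel c x i j) (at (snd c p)))"
  using has_derivative_linear[OF smooth_on_has_derivative[OF christoffel_smooth[OF assms(1)]]] assms(2) by blast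

text \<open>In a frame, the Ricci curvature is the trace of the endomorphism \<open>E \<mapsto> R(X, E)Y\<close>, in
  which the metric no longer occurs; so it may be computed in any chart.\<close>

lemma Ric_chart:
  assumes c: "c \<in> atlas" and p: "p \<in> fst c - sing" and X: "X \<in> vector_fields M" and Y: "Y \<in> vector_fields M"
  shows "Ric D X Y p = (\<Sum>k\<in>UNIV. riem (christoffel c) (snd c p) (X p c) (axis k 1) (Y p c) $ k)"
proof -
  have cp: "c \<in> charts_at p" using c p by (simp add: charts_at_iff)
  \<comment> \<open>\<open>Ric\<close> takes its trace in this chart picked by choice; the
    computation takes place on its overlap with c.\<close>
  define c' where "c' = (SOME c. c \<in> charts_at p)"
  have cp': "c' \<in> charts_at p" unfolding c'_def using cp by (rule someI)
  then have c': "c' \<in> atlas" "p \<in> fst c'" by (auto simp: charts_at_iff)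
  let ?W = "(fst c - sing) \<inter> fst c'"
  have W: "open ?W" "?W \<subseteq> fst c - sing" "?W \<subseteq> M" "?W \<subseteq> M - sing" "p \<in> ?W"
    using open_chart_diff_sing[OF c] chart_domain(1)[OF c'(1)] chart_domain(2)[OF c] p c' by auto
  have XY: "X \<in> vector_fields ?W" "Y \<in> vector_fields ?W"
    using X Y W(3) vector_fields_subset by blast+
  have E: "coord c' i \<in> vector_fields ?W" for i
    using vector_fields_subset[OF coord_vector_field[OF c'(1)]] by blast
  let ?T = "\<lambda>v. riem (christoffel c) (snd c p) (X p c) v (Y p c)"
  let ?R = "\<lambda>i. curv D X (coord c' i) Y p"
  have R: "?R i \<in> tangent p" for i by (rule curv_tangent[OF W(1,4) XY(1) E XY(2) W(5)])
  have Rc: "?R i c' = jac c c' p (?T (jac c' c p (axis i 1)))" for i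
    using tangent_jac[OF R cp cp', of i] curv_chart[OF c W(1,2) XY(1) E XY(2) W(5), of i] cp
    by (simp add: coord_def)
  have det: "det (gram c' p) \<noteq> 0" using sing_iff[OF cp'] p by simp
  have "Ric D X Y p = (\<Sum>i\<in>UNIV. (matrix_inv (gram c' p) *v (gram c' p *v ?R i c')) $ i)"
    unfolding Ric_def c'_def[symmetric] Let_def ip_def
    by (simp add: g_chart[OF cp' R coord_tangent[OF cp']] coord_self[OF cp'] inner_axis matrix_vector_mult_def)
  also have "\<dots> = (\<Sum>i\<in>UNIV. jac c c' p (?T (jac c' c p (axis i 1))) $ i)"
    by (simp add: matrix_inv_vector_mult[OF det] Rc)
  also have "\<dots> = (\<Sum>k\<in>UNIV. ?T (axis k 1) $ k)"
    by (rule trace_conjugate)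
       (auto intro: bounded_linear.linear jac_linear cp cp' riem_linear_middle christoffel_derivative_linear[OF c p]
         simp: jac_comp[OF cp cp' cp] jac_self[OF cp])
  finally show ?thesis .
qed

end

end

section \<open>The Ricci curvature near the singular hypersurface\<close>

context smooth_manifold
begin

lemma open_M: "open M"
  using chart_domain(1) cover by (metis open_UN)

end

context tangent_radical_riemann_lorentz
begin

text \<open>A radical vector is the velocity of a curve in the singular set, along which the
  determinant is constantly 0; the chain rule at parameter 0 gives the claim.\<close>

lemma radical_derivative:
  assumes c: "c \<in> charts_at p" and p: "p \<in> sing" and r: "gram c p *v r = 0"
  shows "frechet_derivative (\<lambda>x. det (gram c (cinv c x))) (at (snd c p)) r = 0"
proof -
  have A: "c \<in> atlas" "p \<in> fst c" using c by (auto simp: charts_at_iff)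
  let ?\<delta> = "\<lambda>x. det (gram c (cinv c x))"
  have "lift c p r \<in> radical p"
    using radical_chart[OF c lift_tangent[OF c]] r lift_self[OF c] by simp
  then have "lift c p r \<in> tangent_sing p" using tangent_radical[OF p] by blast
  then obtain \<gamma> \<epsilon> where \<gamma>: "0 < \<epsilon>" "smooth_curve {-\<epsilon><..<\<epsilon>} \<gamma>" "\<gamma> 0 = p"
    "\<And>t. t \<in> {-\<epsilon><..<\<epsilon>} \<Longrightarrow> \<gamma> t \<in> sing" "r = vector_derivative (snd c \<circ> \<gamma>) (at 0)"
    using lift_self[OF c] c unfolding tangent_sing_def by force
  define T where "T = {t \<in> {-\<epsilon><..<\<epsilon>}. \<gamma> t \<in> fst c}"
  have "open ({-\<epsilon><..<\<epsilon>} \<inter> \<gamma> -` fst c)"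
    using \<gamma>(2) chart_domain(1)[OF A(1)] by (intro continuous_open_preimage) (auto simp: smooth_curve_def)
  moreover have "{-\<epsilon><..<\<epsilon>} \<inter> \<gamma> -` fst c = T" by (auto simp: T_def)
  ultimately have T: "open T" "0 \<in> T" using \<gamma>(1,3) A(2) by (auto simp: T_def)
  have "smooth_on T (snd c \<circ> \<gamma>)" using \<gamma>(2) A(1) by (auto simp: smooth_curve_def T_def)
  then have "(snd c \<circ> \<gamma>) differentiable at 0"
    using smooth_on_has_derivative T(2) unfolding differentiable_def by blast
  then have "((\<lambda>t. snd c (\<gamma> t)) has_derivative (\<lambda>h. h *\<^sub>R r)) (at 0)"
    using \<gamma>(5) by (simp add: vector_derivative_works has_vector_derivative_def comp_def)
  moreover have "(?\<delta> has_derivative frechet_derivative ?\<delta> (at (snd c (\<gamma> 0)))) (at (snd c (\<gamma> 0)))"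
    by (rule smooth_on_has_derivative[OF det_gram_smooth[OF A(1)]]) (use A(2) \<gamma>(3) in auto)
  ultimately have "((\<lambda>t. ?\<delta> (snd c (\<gamma> t))) has_derivative (\<lambda>h. frechet_derivative ?\<delta> (at (snd c (\<gamma> 0))) (h *\<^sub>R r))) (at 0)"
    by (rule has_derivative_compose)
  then have "((\<lambda>t. 0) has_derivative (\<lambda>h. frechet_derivative ?\<delta> (at (snd c (\<gamma> 0))) (h *\<^sub>R r))) (at 0)"
    by (rule has_derivative_transform_within_open[OF _ T])
       (use \<gamma>(4) sing_iff[of c] A(1) in \<open>auto simp: T_def charts_at_iff\<close>)
  from fun_cong[OF has_derivative_unique[OF this has_derivative_const], of 1]
  show ?thesis by (simp add: \<gamma>(3))
qed

lemma extends_add_zero: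
  assumes "extends M X A" "U \<in> vector_fields M" "\<And>p. p \<in> sing \<Longrightarrow> U p = (\<lambda>_. 0)"
  shows "extends M (\<lambda>p c. X p c + U p c) A"
  using assms vector_fields_add[OF open_M] by (auto simp: extends_def)

section \<open>Bilinearity and blow-up of the Ricci curvature\<close>

context
  fixes D :: "('a, 'n) connection"
  assumes D: "levi_civita D"
begin

text \<open>By \<open>Ric_chart\<close> the value at p depends on the fields only through their
  values at p, as arguments of \<open>riem\<close>, which is linear in them.\<close>

lemma Ric_add:
  assumes p: "p \<in> M - sing" and V: "X \<in> vector_fields M" "Y \<in> vector_fields M" "U \<in> vector_fields M"
  shows "Ric D (\<lambda>p c. X p c + U p c) Y p = Ric D X Y p + Ric D U Y p"
    and "Ric D Y (\<lambda>p c. X p c + U p c) p = Ric D Y X p + Ric D Y U p"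
proof -
  obtain c where c: "c \<in> atlas" "p \<in> fst c - sing" using p cover by blast
  note Ric = Ric_chart[OF D c]
  note lin = christoffel_derivative_linear[OF D c]
  show "Ric D (\<lambda>p c. X p c + U p c) Y p = Ric D X Y p + Ric D U Y p"
    by (simp add: Ric V vector_fields_add[OF open_M] linear_add[OF riem_linear_left[OF lin]] sum.distrib)
  show "Ric D Y (\<lambda>p c. X p c + U p c) p = Ric D Y X p + Ric D Y U p"
    by (simp add: Ric V vector_fields_add[OF open_M] linear_add[OF riem_linear_right] sum.distrib)
qed

text \<open>Tensoriality again: only the value of U at p matters, and each of the two slots
  contributes one factor s.\<close>

lemma Ric_scaled_coord:
  assumes c: "c \<in> atlas" and p: "p \<in> fst c - sing" and U: "U \<in> vector_fields M"
    and Up: "U p = (\<lambda>c'. s *\<^sub>R coord c a p c')"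
  shows "Ric D U U p =
    s\<^sup>2 * (\<Sum>k\<in>UNIV. riem (christoffel D c) (snd c p) (axis a 1) (axis k 1) (axis a 1) $ k)"
proof -
  have "c \<in> charts_at p" using c p by (simp add: charts_at_iff)
  then have "U p c = s *\<^sub>R axis a 1" by (simp add: Up coord_self)
  then show ?thesis
    by (simp add: Ric_chart[OF D c p U U] linear_scale[OF riem_linear_left[OF christoffel_derivative_linear[OF D c p]]]
        linear_scale[OF riem_linear_right] sum_distrib_left power2_eq_square mult.assoc)
qed

lemma christoffel_ricci_limit:
  fixes c p a
  defines "\<delta> \<equiv> \<lambda>x. det (gram c (cinv c x))"
  assumes c: "c \<in> charts_at p" and p: "p \<in> sing"
  shows "((\<lambda>x. (\<delta> x)\<^sup>2 * (\<Sum>k\<in>UNIV. riem (christoffel D c) x (axis a 1) (axis k 1) (axis a 1) $ k)) \<longlongrightarrow>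
      - (frechet_derivative \<delta> (at (snd c p)) (axis a 1))\<^sup>2 / 4) (at (snd c p) within snd c ` (fst c - sing))"
    and "at (snd c p) within snd c ` (fst c - sing) \<noteq> bot"
proof -
  have A: "c \<in> atlas" "p \<in> fst c" using c by (auto simp: charts_at_iff)
  let ?S = "snd c ` fst c"
  have reg: "{x \<in> ?S. det (gram c (cinv c x)) \<noteq> 0} = snd c ` (fst c - sing)"
    using sing_iff[of c] A(1) by (auto simp: charts_at_iff)
  have sym: "gram c (cinv c x) $ i $ j = gram c (cinv c x) $ j $ i" if "x \<in> ?S" for x i j
    using that gram_sym[of c] A(1) by (auto simp: charts_at_iff)
  have 0: "det (gram c (cinv c (snd c p))) = 0"
    using p sing_iff[OF c] A by simp
  have d: "frechet_derivative (\<lambda>x. det (gram c (cinv c x))) (at (snd c p)) \<noteq> (\<lambda>_. 0)"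
    using is_transverse A p by (auto simp: transverse_def)
  have t: "gram c (cinv c (snd c p)) *v r = 0 \<Longrightarrow>
      frechet_derivative (\<lambda>x. det (gram c (cinv c x))) (at (snd c p)) r = 0" for r
    using radical_derivative[OF c p] A by simp
  \<comment> \<open>The facts stand in the order of the assumptions of the coordinate context, of
    which both claims are instances.\<close>
  note prems = chart_domain(3)[OF A(1)] imageI[OF A(2), of "snd c"] gram_smooth[OF A(1)] sym 0 d t
  have K: "(gram c (cinv c x) *v christoffel D c x i j) $ k =
      (frechet_derivative (\<lambda>x. gram c (cinv c x) $ j $ k) (at x) (axis i 1)
       + frechet_derivative (\<lambda>x. gram c (cinv c x) $ i $ k) (at x) (axis j 1)
       - frechet_derivative (\<lambda>x. gram c (cinv c x) $ i $ j) (at x) (axis k 1)) / 2"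
    if "x \<in> snd c ` (fst c - sing)" for x i j k
    using that christoffel_koszul[OF D A(1)] A(1) by auto
  show "((\<lambda>x. (\<delta> x)\<^sup>2 * (\<Sum>k\<in>UNIV. riem (christoffel D c) x (axis a 1) (axis k 1) (axis a 1) $ k)) \<longlongrightarrow>
      - (frechet_derivative \<delta> (at (snd c p)) (axis a 1))\<^sup>2 / 4) (at (snd c p) within snd c ` (fst c - sing))"
    unfolding \<delta>_def reg[symmetric]
    by (rule ricci_limit[OF prems]) (simp_all add: reg christoffel_smooth[OF D A(1)] K)
  show "at (snd c p) within snd c ` (fst c - sing) \<noteq> bot"
    unfolding reg[symmetric] by (rule at_reg_nontrivial[OF prems])
qed

text \<open>The factor \<delta> does two jobs: it makes U vanish on the singular set, and its square
  compensates the double pole. The bump function makes U global.\<close>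

lemma vanishing_field_with_Ric_limit:
  assumes c: "c \<in> charts_at p" and p: "p \<in> sing"
  obtains U l where "U \<in> vector_fields M" "\<And>q. q \<in> sing \<Longrightarrow> U q = (\<lambda>_. 0)" "l \<noteq> 0"
    "((\<lambda>x. Ric D U U (cinv c x)) \<longlongrightarrow> l) (at (snd c p) within snd c ` (fst c - sing))"
proof -
  have A: "c \<in> atlas" "p \<in> fst c" using c by (auto simp: charts_at_iff)
  let ?S = "snd c ` fst c" and ?x = "snd c p"
  define \<delta> where "\<delta> x = det (gram c (cinv c x))" for x
  have \<delta>_smooth: "smooth_on ?S \<delta>" unfolding \<delta>_def by (rule det_gram_smooth[OF A(1)])
  have "frechet_derivative \<delta> (at ?x) \<noteq> (\<lambda>_. 0)"
    using is_transverse A p by (auto simp: transverse_def \<delta>_def[abs_def])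
  then obtain v where "frechet_derivative \<delta> (at ?x) v \<noteq> 0" by auto
  moreover have "linear (frechet_derivative \<delta> (at ?x))"
    by (rule has_derivative_linear[OF smooth_on_has_derivative[OF \<delta>_smooth]]) (use A in auto)
  \<comment> \<open>A linear form that vanished on all unit vectors would be zero.\<close>
  ultimately obtain a where a: "frechet_derivative \<delta> (at ?x) (axis a 1) \<noteq> 0"
    using linear_vec_expand[of "frechet_derivative \<delta> (at ?x)" v] by (metis (no_types, lifting) scaleR_zero_right sum.neutral)
  obtain r where r: "r > 0" "cball ?x r \<subseteq> ?S"
    using chart_domain(3)[OF A(1)] A(2) open_contains_cball by blast
  obtain \<beta> :: "real ^ 'n \<Rightarrow> real" where \<beta>: "smooth_on UNIV \<beta>" "\<beta> ?x \<noteq> 0" "\<And>x. x \<notin> cball ?x r \<Longrightarrow> \<beta> x = 0"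
    using smooth_bump[OF r(1)] by blast
  define K where "K = cinv c ` cball ?x r"
  \<comment> \<open>Compactness makes K closed in the whole Hausdorff space, not just in the chart
    domain, as extension by zero requires.\<close>
  have "compact K"
    unfolding K_def using homeomorphism_cont2[OF chart_homeomorphism[OF A(1)]] r(2)
    by (intro compact_continuous_image) (auto intro: continuous_on_subset)
  then have K: "closed K" "K \<subseteq> fst c"
    using r(2) A(1) by (auto simp: K_def compact_imp_closed dest!: subsetD)
  \<comment> \<open>Values of \<open>snd c\<close> off the chart domain carry no meaning, so 0 is
    prescribed there explicitly.\<close>
  define f where "f q = (if q \<in> fst c then \<beta> (snd c q) * \<delta> (snd c q) else 0)" for q
  have "smooth_fun (fst c) f"
  proof (rule smooth_fun_chartI[OF A(1) chart_domain(1)[OF A(1)] order_refl])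
    have "smooth_on ?S (\<lambda>x. \<beta> x * \<delta> x)"
      by (intro smooth_on_mult chart_domain A(1) \<delta>_smooth smooth_on_subset[OF \<beta>(1)]) auto
    then show "smooth_on ?S (\<lambda>x. f (cinv c x))"
      by (rule smooth_on_cong[THEN iffD1, rotated -1]) (use A(1) chart_domain(3) in \<open>auto simp: f_def\<close>)
  qed
  define U where "U q c' = f q *\<^sub>R coord c a q c'" for q c'
  have f0: "f q = 0" if "q \<notin> K" for q
  proof (cases "q \<in> fst c")
    case True
    then have "snd c q \<notin> cball ?x r" using that A(1) unfolding K_def by (metis cinv_snd imageI)
    then show ?thesis by (simp add: f_def \<beta>(3))
  qed (simp add: f_def)
  have "U \<in> vector_fields (fst c)"
    unfolding U_def by (rule vector_fields_scaleR) (use \<open>smooth_fun (fst c) f\<close> A chart_domain coord_vector_field in auto)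
  then have U: "U \<in> vector_fields M"
    by (rule vector_fields_extend_zero[OF A(1) K]) (simp add: U_def[abs_def] f0)
  have "f q = 0" if "q \<in> sing" for q
    using that sing_iff[of c q] A(1) by (auto simp: f_def \<delta>_def charts_at_iff)
  then have U0: "U q = (\<lambda>_. 0)" if "q \<in> sing" for q using that by (simp add: U_def[abs_def])
  let ?\<rho> = "\<lambda>x. \<Sum>k\<in>UNIV. riem (christoffel D c) x (axis a 1) (axis k 1) (axis a 1) $ k"
  let ?l = "(\<beta> ?x)\<^sup>2 * (- (frechet_derivative \<delta> (at ?x) (axis a 1))\<^sup>2 / 4)"
  have "isCont \<beta> ?x"
    using smooth_on_continuous_on[OF \<beta>(1)] continuous_on_eq_continuous_at by blast
  then have "(\<beta> \<longlongrightarrow> \<beta> ?x) (at ?x within snd c ` (fst c - sing))"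
    unfolding isCont_def by (rule tendsto_within_subset) simp
  then have "((\<lambda>x. (\<beta> x)\<^sup>2 * ((\<delta> x)\<^sup>2 * ?\<rho> x)) \<longlongrightarrow> ?l) (at ?x within snd c ` (fst c - sing))"
    using christoffel_ricci_limit(1)[OF c p, of a] unfolding \<delta>_def[symmetric] by (intro tendsto_mult tendsto_power)
  then have lim: "((\<lambda>x. Ric D U U (cinv c x)) \<longlongrightarrow> ?l) (at ?x within snd c ` (fst c - sing))"
  proof (rule Lim_transform_eventually)
    have "(\<beta> x)\<^sup>2 * ((\<delta> x)\<^sup>2 * ?\<rho> x) = Ric D U U (cinv c x)" if x: "x \<in> snd c ` (fst c - sing)" for x
    proof -
      obtain q where q: "q \<in> fst c - sing" "x = snd c q" using x by blast
      have "Ric D U U q = (f q)\<^sup>2 * ?\<rho> (snd c q)"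
        by (rule Ric_scaled_coord[OF A(1) q(1) U]) (simp add: U_def[abs_def])
      then show ?thesis using q A(1) by (simp add: f_def power_mult_distrib)
    qed
    then show "\<forall>\<^sub>F x in at ?x within snd c ` (fst c - sing). (\<beta> x)\<^sup>2 * ((\<delta> x)\<^sup>2 * ?\<rho> x) = Ric D U U (cinv c x)"
      unfolding eventually_at_filter by (intro eventuallyI impI)
  qed
  have "?l \<noteq> 0" using \<beta>(2) a by simp
  show ?thesis by (rule that[OF U U0 \<open>?l \<noteq> 0\<close> lim])
qed

lemma Ric_not_well_defined:
  assumes "A \<in> fields_along M" "B \<in> fields_along M"
  shows "\<not> Ric_well_defined D A B"
proof
  assume wd: "Ric_well_defined D A B"
  obtain p where p: "p \<in> sing" using sing_nonempty by blast
  then have "p \<in> M" by (simp add: sing_def)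
  then obtain c where c: "c \<in> charts_at p" using cover by (auto simp: charts_at_def)
  then have cA: "c \<in> atlas" "p \<in> fst c" by (auto simp: charts_at_iff)
  obtain U l where U: "U \<in> vector_fields M" "\<And>q. q \<in> sing \<Longrightarrow> U q = (\<lambda>_. 0)" "l \<noteq> 0"
    "((\<lambda>x. Ric D U U (cinv c x)) \<longlongrightarrow> l) (at (snd c p) within snd c ` (fst c - sing))"
    using vanishing_field_with_Ric_limit[OF c p] by blast
  obtain X Y where X: "extends M X A" and Y: "extends M Y B"
    using assms by (auto simp: fields_along_def)
  \<comment> \<open>Perturbing the two slots independently by the same U gives four pairs of
    extensions of A and B.\<close>
  let ?X = "\<lambda>p c. X p c + U p c" and ?Y = "\<lambda>p c. Y p c + U p c"
  have X': "extends M ?X A" and Y': "extends M ?Y B"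
    using extends_add_zero U X Y by blast+
  have V: "X \<in> vector_fields M" "Y \<in> vector_fields M" "?X \<in> vector_fields M" "?Y \<in> vector_fields M"
    using X Y X' Y' by (auto simp: extends_def)
  note ex = wd[unfolded Ric_well_defined_def, THEN conjunct1, rule_format, OF conjI]
  obtain F1 F2 F3 F4 where F: "Ric_extension D X Y F1" "Ric_extension D ?X Y F2"
    "Ric_extension D X ?Y F3" "Ric_extension D ?X ?Y F4"
    using ex[OF X Y] ex[OF X' Y] ex[OF X Y'] ex[OF X' Y'] by blast
  have agree: "F p = F' p"
    if "extends M X A" "extends M Y B" "extends M X' A" "extends M Y' B"
      "Ric_extension D X Y F" "Ric_extension D X' Y' F'" for X Y X' Y' F F'
    using wd that p unfolding Ric_well_defined_def by blast
  have eq: "F2 p = F1 p" "F3 p = F1 p" "F4 p = F1 p"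
    by (rule agree[OF X' Y X Y F(2,1)], rule agree[OF X Y' X Y F(3,1)], rule agree[OF X' Y' X Y F(4,1)])
  \<comment> \<open>The polarisation: off the singular set the cross terms cancel and leave Ric(U,
    U), while at p the four smooth extensions agree and H is 0.\<close>
  define H where "H q = F4 q - F3 q - F2 q + F1 q" for q
  have HRic: "H q = Ric D U U q" if q: "q \<in> M - sing" for q
  proof -
    have "F1 q = Ric D X Y q" "F2 q = Ric D ?X Y q" "F3 q = Ric D X ?Y q" "F4 q = Ric D ?X ?Y q"
      using F q unfolding Ric_extension_def by blast+
    with Ric_add(1)[OF q V(1) V(2) U(1)] Ric_add(1)[OF q V(1) V(4) U(1)] Ric_add(2)[OF q V(2) U(1) U(1)]
    show ?thesis unfolding H_def by linarith
  qed
  have sm: "smooth_on (snd c ` fst c) (\<lambda>x. F (cinv c x))" if "smooth_fun M F" for F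
    using smooth_funD[OF that cA(1)] chart_domain(2)[OF cA(1)] by (simp add: Int_absorb2)
  have "continuous_on (snd c ` fst c) (\<lambda>x. H (cinv c x))"
    unfolding H_def using F
    by (intro continuous_intros smooth_on_continuous_on sm) (auto simp: Ric_extension_def)
  then have "isCont (\<lambda>x. H (cinv c x)) (snd c p)"
    using chart_domain(3)[OF cA(1)] cA(2) continuous_on_eq_continuous_at by blast
  then have "((\<lambda>x. H (cinv c x)) \<longlongrightarrow> H (cinv c (snd c p))) (at (snd c p) within snd c ` (fst c - sing))"
    unfolding isCont_def by (rule tendsto_within_subset) simp
  moreover have "((\<lambda>x. H (cinv c x)) \<longlongrightarrow> l) (at (snd c p) within snd c ` (fst c - sing))"
  proof (rule Lim_transform_eventually[OF U(4)])
    have "Ric D U U (cinv c x) = H (cinv c x)" if "x \<in> snd c ` (fst c - sing)" for x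
      using that HRic chart_domain(2)[OF cA(1)] cA(1) by auto
    then show "\<forall>\<^sub>F x in at (snd c p) within snd c ` (fst c - sing). Ric D U U (cinv c x) = H (cinv c x)"
      unfolding eventually_at_filter by (intro eventuallyI impI)
  qed
  \<comment> \<open>Continuity makes the value of H at p the limit l along regular points;
    uniqueness of that limit rests on their accumulating at p.\<close>
  ultimately have "H (cinv c (snd c p)) = l"
    by (rule tendsto_unique[OF christoffel_ricci_limit(2)[OF c p]])
  then have "H p = l" using cA by simp
  moreover have "H p = 0" using eq by (simp add: H_def)
  ultimately show False using U(3) by simp
qed

end

end

theorem proposition23:
  fixes M :: "'a::{t2_space, second_countable_topology} set"
    and atlas :: "('a, 'n::finite) chart set"
    and g :: "'a \<Rightarrow> ('a, 'n) tvec \<Rightarrow> ('a, 'n) tvec \<Rightarrow> real"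
    and D :: "('a, 'n) connection"
    and A B :: "('a, 'n) vfield"
  assumes "tangent_radical_riemann_lorentz M atlas g"
    and "metric_manifold.levi_civita M atlas g D"
    and "A \<in> metric_manifold.fields_along M atlas g M"
    and "B \<in> metric_manifold.fields_along M atlas g M"
  shows "\<not> metric_manifold.Ric_well_defined M atlas g D A B \<and>
    (metric_manifold.III_flat M atlas g D \<longrightarrow>
      \<not> metric_manifold.Ric_well_defined M atlas g D A B)"
  using tangent_radical_riemann_lorentz.Ric_not_well_defined[OF assms] by simp

end
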